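(* Let $(\mathfrak X,d)$ be a separable and complete CC space. 1) For integrable $\mathfrak X$-valued random elements $X_1,X_2$ and $\lambda_1,\lambda_2>0$ with $\lambda_1+\lambda_2=1$, $E([\lambda_1,X_1;\lambda_2,X_2])=[\lambda_1,EX_1;\lambda_2,EX_2]$. 2) Suppose that $X$ is an integrable $\mathfrak X$-valued random element and $\xi$ is a real-valued random variable such that $0<\xi<1$ a.s. If $\xi$ and $X$ are independent, then $E([\xi,X;1-\xi,u])=[E\xi,EX;1-E\xi,Ku]$ for $u\in\mathfrak X$. 3) Let $\xi$ be a real-valued random variable such that $0<\xi<1$ a.s. Then $E([\xi,u;1-\xi,v])=[E\xi,Ku;1-E\xi,Kv]$ for all $u,v\in\mathfrak X$.
   Context: A convex combination space (CC space) is a metric space $(\mathfrak X,d)$ endowed with a convex combination operation, which to all $n\ge1$, all $\lambda_1,\dots,\lambda_n>0$ with $\sum_{i=1}^n\lambda_i=1$ and all $u_1,\dots,u_n\in\mathfrak X$ assigns an element $[\lambda_1,u_1;\dots;\lambda_n,u_n]=[\lambda_i,u_i]_{i=1}^n$ of $\mathfrak X$, with $[1,u]=u$, and such that: (CC.i) $[\lambda_i,u_i]_{i=1}^n=[\lambda_{\sigma(i)},u_{\sigma(i)}]_{i=1}^n$ for every permutation $\sigma$ of $\{1,\dots,n\}$; (CC.ii) $[\lambda_i,u_i]_{i=1}^{n+2}=\big[\lambda_1,u_1;\dots;\lambda_n,u_n;\lambda_{n+1}+\lambda_{n+2},\big[\tfrac{\lambda_{n+j}}{\lambda_{n+1}+\lambda_{n+2}},u_{n+j}\big]_{j=1}^2\big]$;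 (CC.iii) if $u,v\in\mathfrak X$ and $\lambda^{(k)}\to\lambda\in(0,1)$ then $[\lambda^{(k)},u;1-\lambda^{(k)},v]\to[\lambda,u;1-\lambda,v]$; (CC.iv) for $u_1,u_2,v_1,v_2\in\mathfrak X$ and $\lambda\in(0,1)$, $d([\lambda,u_1;1-\lambda,u_2],[\lambda,v_1;1-\lambda,v_2])\le\lambda d(u_1,v_1)+(1-\lambda)d(u_2,v_2)$; (CC.v) for each $u\in\mathfrak X$ the limit $Ku:=\lim_{n\to\infty}[n^{-1},u]_{i=1}^n$ exists in $\mathfrak X$; $K$ is called the convexification operator. Write $K(\mathfrak X)=\{Ku:u\in\mathfrak X\}$; $K$ is idempotent. For points of $K(\mathfrak X)$, weights in $[0,1]$ are allowed by discarding entries with weight $0$. $(\Omega,\mathcal F,P)$ is a complete probability space without atoms. A random element is a map $X:\Omega\to\mathfrak X$ measurable with respect to $\mathcal F$ and the Borel $\sigma$-algebra; it is integrable if $d(u,X)$ is integrable for some (equivalently every) $u\in\mathfrak X$. Convex combinations of random elements (with constant or random weights) are taken pointwise in $\omega$. A simple random element takes finitely many values; if $X=x_i$ on $\Omega_i$, where $\Omega_1,\dots,\Omega_n$ is a measurable partition of $\Omega$, write $X=[I_{\Omega_i},x_i]_{i=1}^n$ and define $EX=[P(\Omega_i),Kx_i]_{i=1}^n$. For integrable $X$: fix $u_0\in K(\mathfrak X)$ and a countable dense set $\{u_j:j\ge1\}\subset\mathfrak X$, let $\psi_n(x)=u_{m_n(x)}$, where $m_n(x)$ is the smallest $i\in\{0,\dots,n\}$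 with $d(u_i,x)=\min_{0\le j\le n}d(u_j,x)$, and define the expectation $EX=\lim_{n\to\infty}E\psi_n(X)$ (the limit exists). *)

theory Defs
  imports "HOL-Probability.Probability" "HOL-Combinatorics.Permutations"
begin

text \<open>
  The combination \<open>[\<lambda>\<^sub>1,u\<^sub>1; \<dots>; \<lambda>\<^sub>n,u\<^sub>n]\<close> is rendered as a function on the list
  \<open>[(\<lambda>\<^sub>1,u\<^sub>1), \<dots>, (\<lambda>\<^sub>n,u\<^sub>n)]\<close>. It is meaningful only on lists satisfying the following predicate;
  outside of it the function is total but unconstrained.
\<close>

definition weighted_points :: "(real \<times> 'a) list \<Rightarrow> bool" where
  "weighted_points ps \<longleftrightarrow>
     ps \<noteq> [] \<and> (\<forall>p\<in>set ps. 0 < fst p) \<and> sum_list (map fst ps) = 1"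

text \<open>
  In \<open>cc_merge\<close> the list \<open>ps\<close> may be empty; that instance already follows from \<open>cc_single\<close>.
\<close>

locale cc_space =
  fixes cc :: "(real \<times> 'a::metric_space) list \<Rightarrow> 'a"
  assumes cc_single: "cc [(1, u)] = u"
    and cc_permute:
      "\<lbrakk>weighted_points ps; \<sigma> permutes {..<length ps}\<rbrakk> \<Longrightarrow> cc (permute_list \<sigma> ps) = cc ps"
    and cc_merge:
      "weighted_points (ps @ [(a, u), (b, v)]) \<Longrightarrow>
        cc (ps @ [(a, u), (b, v)]) =
        cc (ps @ [(a + b, cc [(a / (a + b), u), (b / (a + b), v)])])"
    and cc_weight_continuous:
      "\<lbrakk>\<And>k::nat. 0 < l k \<and> l k < 1; l \<longlonglongrightarrow> t; 0 < t; t < 1\<rbrakk> \<Longrightarrow>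
        (\<lambda>k. cc [(l k, u), (1 - l k, v)]) \<longlonglongrightarrow> cc [(t, u), (1 - t, v)]"
    and cc_dist_le:
      "\<lbrakk>0 < t; t < 1\<rbrakk> \<Longrightarrow>
        dist (cc [(t, u1), (1 - t, u2)]) (cc [(t, v1), (1 - t, v2)])
          \<le> t * dist u1 v1 + (1 - t) * dist u2 v2"
    and cc_average_convergent:
      "convergent (\<lambda>n. cc (replicate (Suc n) (1 / real (Suc n), u)))"

definition convexification :: "((real \<times> 'a::metric_space) list \<Rightarrow> 'a) \<Rightarrow> 'a \<Rightarrow> 'a" where
  "convexification cc u = lim (\<lambda>n. cc (replicate (Suc n) (1 / real (Suc n), u)))"

definition discard_zero_weights :: "(real \<times> 'a) list \<Rightarrow> (real \<times> 'a) list" where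
  "discard_zero_weights ps = filter (\<lambda>p. fst p \<noteq> 0) ps"

definition atomless :: "'w measure \<Rightarrow> bool" where
  "atomless M \<longleftrightarrow>
     (\<forall>A\<in>sets M. 0 < measure M A \<longrightarrow>
        (\<exists>B\<in>sets M. B \<subseteq> A \<and> 0 < measure M B \<and> measure M B < measure M A))"

definition integrable_element :: "'w measure \<Rightarrow> ('w \<Rightarrow> 'a::metric_space) \<Rightarrow> bool" where
  "integrable_element M X \<longleftrightarrow>
     X \<in> borel_measurable M \<and> (\<exists>u. integrable M (\<lambda>\<omega>. dist u (X \<omega>)))"

text \<open>
  The expectation of a simple random element, taken over the partition of the space into the
  preimages of the distinct values of \<open>X\<close>. The enumeration of the values does not matter
  because of \<open>cc_permute\<close>.
\<close>

definition simple_expectation ::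
  "((real \<times> 'a::metric_space) list \<Rightarrow> 'a) \<Rightarrow> 'w measure \<Rightarrow> ('w \<Rightarrow> 'a) \<Rightarrow> 'a" where
  "simple_expectation cc M X =
     (let xs = (SOME xs. distinct xs \<and> set xs = X ` space M)
      in cc (discard_zero_weights
           (map (\<lambda>x. (measure M (X -` {x} \<inter> space M), convexification cc x)) xs)))"

text \<open>
  The base point and dense set used for approximation form one sequence \<open>w\<close>: \<open>w 0\<close> is the base
  point in the range of the convexification operator and \<open>w 1, w 2, \<dots>\<close> enumerates the dense set
  (repetitions are allowed, so that finite spaces are covered).
\<close>

definition approximating_sequence ::
  "((real \<times> 'a::metric_space) list \<Rightarrow> 'a) \<Rightarrow> (nat \<Rightarrow> 'a) \<Rightarrow> bool" where
  "approximating_sequence cc w \<longleftrightarrow>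
     w 0 \<in> range (convexification cc) \<and> closure (w ` {1..}) = UNIV"

definition nearest_index :: "(nat \<Rightarrow> 'a::metric_space) \<Rightarrow> nat \<Rightarrow> 'a \<Rightarrow> nat" where
  "nearest_index w n x =
     (LEAST i. i \<le> n \<and> dist (w i) x = Min ((\<lambda>j. dist (w j) x) ` {0..n}))"

definition nearest_point :: "(nat \<Rightarrow> 'a::metric_space) \<Rightarrow> nat \<Rightarrow> 'a \<Rightarrow> 'a" where
  "nearest_point w n x = w (nearest_index w n x)"

definition cc_expectation ::
  "((real \<times> 'a::metric_space) list \<Rightarrow> 'a) \<Rightarrow> (nat \<Rightarrow> 'a) \<Rightarrow> 'w measure \<Rightarrow> ('w \<Rightarrow> 'a) \<Rightarrow> 'a"
  where
  "cc_expectation cc w M X =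
     lim (\<lambda>n. simple_expectation cc M (\<lambda>\<omega>. nearest_point w n (X \<omega>)))"

text \<open>
  \<open>indep_var\<close> requires both variables to have the same codomain type, so independence
  is stated for the generated \<open>\<sigma>\<close>-algebras.
\<close>

definition independent_elements ::
  "'w measure \<Rightarrow> ('w \<Rightarrow> 'b::topological_space) \<Rightarrow> ('w \<Rightarrow> 'c::topological_space) \<Rightarrow> bool" where
  "independent_elements M X Y \<longleftrightarrow>
     prob_space.indep_set M
       (sets (vimage_algebra (space M) X borel)) (sets (vimage_algebra (space M) Y borel))"

end

theory Submission
  imports Defs
begin

text \<open>
  On the fixed points of the convexification operator \<open>K\<close> equal points can be merged, so that there a
  convex combination depends only on the discrete law formed by its weights and points. Simple
  expectations thus become barycentres of finitely supported probability mass functions, which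
  are compatible with the monadic bind (iterated combinations collapse) and are Lipschitz in the
  points. Since \<open>K\<close> commutes with convex combinations and \<open>[t, x; 1 - t, y]\<close> is the
  barycentre of a Bernoulli law, for simple random elements the claims are commutations of binds: for
  random weights, mixing Bernoulli laws over the law of \<open>\<xi>\<close> gives the Bernoulli law with
  parameter \<open>E \<xi>\<close>. The general case follows by approximation, since the distance of two
  simple expectations is at most the mean of \<open>d (K X) (K Y)\<close>.
\<close>

section \<open>Combinations of lists of weighted points\<close>

text \<open>Laws cannot be used on the whole space: \<open>[t, x; 1 - t, x]\<close> may differ from
  \<open>x\<close>, so splitting an entry can change a combination. Simple expectations escape this
  because they apply \<open>K\<close> to every point before combining. A second obstacle lies in the
  definition of the expectation. For a combined element it uses the points nearest to that element,
  whereas the computation yields combinations of the points nearest to its constituents. The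
  mean-distance bound removes the discrepancy: any simple elements \<open>S n\<close> for which the
  mean distance of \<open>K (S n)\<close> to \<open>K Z\<close> tends to 0 lead to the expectation
  of \<open>Z\<close>. The same bound shows that the defining limit exists. A random weight is
  discretized by a Borel function of itself alone, so independence survives and the joint law of the
  simple elements is a product. As \<xi> lies strictly between 0 and 1 only almost surely and
  combinations are unconstrained otherwise, measurability of the combined element rests on
  completeness of the measure.\<close>

lemma weighted_points_cong:
  "map fst ps = map fst qs \<Longrightarrow> weighted_points ps \<longleftrightarrow> weighted_points qs"
proof -
  have *: "weighted_points ps \<longleftrightarrow> map fst ps \<noteq> [] \<and> (\<forall>a\<in>set (map fst ps). 0 < a) \<and> sum_list (map fst ps) = 1"
    for ps :: "(real \<times> 'c) list"
    by (auto simp: weighted_points_def)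
  show "map fst ps = map fst qs \<Longrightarrow> ?thesis"
    unfolding * by simp
qed

lemma weighted_points_mset:
  assumes "mset ps = mset qs"
  shows "weighted_points ps \<longleftrightarrow> weighted_points qs"
proof -
  have "sum_list (map fst ps) = sum_list (map fst qs)"
    by (metis assms mset_map sum_mset_sum_list)
  moreover have "set ps = set qs"
    by (metis assms set_mset_mset)
  moreover have "ps = [] \<longleftrightarrow> qs = []"
    using assms by (metis mset_zero_iff)
  ultimately show ?thesis
    by (simp add: weighted_points_def)
qed

lemma weighted_points_append_scaled:
  assumes "weighted_points (qs @ [(a, x)])" "weighted_points ps"
  shows "weighted_points (qs @ map (\<lambda>(b, u). (a * b, u)) ps)"
proof -
  have "sum_list (map fst (map (\<lambda>(b, u). (a * b, u)) ps)) = a * sum_list (map fst ps)"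
    by (simp add: sum_list_const_mult o_def case_prod_beta)
  moreover have "0 < a"
    using assms(1) by (auto simp: weighted_points_def)
  ultimately show ?thesis
    using assms by (auto simp: weighted_points_def)
qed

context cc_space
begin

abbreviation K :: "'a \<Rightarrow> 'a" where
  "K \<equiv> convexification cc"

text \<open>\<open>cc_merge\<close> acts at the end of a list only, so entries have to be moved
  there; equality of multisets justifies the move without naming a permutation.\<close>

lemma cc_mset:
  assumes "weighted_points ps" "mset qs = mset ps"
  shows "cc qs = cc ps"
proof -
  obtain \<sigma> where "\<sigma> permutes {..<length ps}" "permute_list \<sigma> ps = qs"
    using mset_eq_permutation[OF assms(2)] by blast
  then show ?thesis
    using cc_permute[OF assms(1)] by blast
qed

text \<open>The last two entries of \<open>ps\<close> are merged until one is left. Scaling by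
  \<open>a\<close> cancels in their relative weights, so both sides reduce to the same shorter
  list.\<close>

lemma cc_merge_scaled:
  assumes "weighted_points ps" "weighted_points (qs @ [(a, x)])"
  shows "cc (qs @ map (\<lambda>(b, u). (a * b, u)) ps) = cc (qs @ [(a, cc ps)])"
  using assms
proof (induction ps arbitrary: qs rule: length_induct)
  case (1 ps)
  have a: "0 < a"
    using 1(3) by (auto simp: weighted_points_def)
  show ?case
  proof (cases "length ps \<le> 1")
    case True
    then obtain b u where ps: "ps = [(b, u)]"
      using 1(2) by (cases ps) (auto simp: weighted_points_def)
    then have "b = 1"
      using 1(2) by (simp add: weighted_points_def)
    then show ?thesis
      by (simp add: ps cc_single)
  next
    case False
    then obtain ps' b u c v where ps: "ps = ps' @ [(b, u), (c, v)]"
    proof -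
      assume *: "\<And>ps' b u c v. ps = ps' @ [(b, u), (c, v)] \<Longrightarrow> thesis"
      obtain rs p where rs: "ps = rs @ [p]"
        using False by (cases ps rule: rev_cases) auto
      obtain rs' p' where "rs = rs' @ [p']"
        using False rs by (cases rs rule: rev_cases) auto
      then show thesis
        using * rs by (metis append.assoc append_Cons append_Nil prod.exhaust)
    qed
    define y where "y = cc [(b / (b + c), u), (c / (b + c), v)]"
    have bc: "0 < b" "0 < c"
      using 1(2) by (auto simp: ps weighted_points_def)
    have 2: "cc ps = cc (ps' @ [(b + c, y)])"
      unfolding ps y_def using 1(2) by (intro cc_merge) (simp add: ps)
    have w: "weighted_points (ps' @ [(b + c, y)])"
      using 1(2) by (auto simp: ps weighted_points_def)
    have "weighted_points (qs @ map (\<lambda>(b, u). (a * b, u)) ps)"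
      by (rule weighted_points_append_scaled[OF 1(3,2)])
    then have "cc (qs @ map (\<lambda>(b, u). (a * b, u)) ps) =
        cc ((qs @ map (\<lambda>(b, u). (a * b, u)) ps') @
          [(a * b + a * c, cc [(a * b / (a * b + a * c), u), (a * c / (a * b + a * c), v)])])"
      using cc_merge[of "qs @ map (\<lambda>(b, u). (a * b, u)) ps'" "a * b" u "a * c" v] by (simp add: ps)
    also have "\<dots> = cc (qs @ map (\<lambda>(b, u). (a * b, u)) (ps' @ [(b + c, y)]))"
      using a bc by (simp add: y_def distrib_left[symmetric])
    also have "\<dots> = cc (qs @ [(a, cc (ps' @ [(b + c, y)]))])"
      using 1(1)[rule_format, of "ps' @ [(b + c, y)]" qs] w 1(3) by (simp add: ps)
    finally show ?thesis
      by (simp add: 2)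
  qed
qed

text \<open>The prefix \<open>qs\<close> takes up one block at a time in collapsed form; the block
  is then moved to the end, where it can be expanded. Admissibility of the expanded list is proved
  alongside, because rearranging presupposes it.\<close>

lemma cc_flatten_append:
  assumes "weighted_points (qs @ map (\<lambda>(a, ps). (a, cc ps)) L)" "\<And>a ps. (a, ps) \<in> set L \<Longrightarrow> weighted_points ps"
  shows "weighted_points (qs @ concat (map (\<lambda>(a, ps). map (\<lambda>(b, u). (a * b, u)) ps) L)) \<and>
    cc (qs @ concat (map (\<lambda>(a, ps). map (\<lambda>(b, u). (a * b, u)) ps) L)) =
    cc (qs @ map (\<lambda>(a, ps). (a, cc ps)) L)"
  using assms
proof (induction L arbitrary: qs)
  case Nil
  then show ?case by simp
next
  case (Cons p L)
  obtain a ps where p: "p = (a, ps)" by fastforce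
  let ?c = "concat (map (\<lambda>(a, ps). map (\<lambda>(b, u). (a * b, u)) ps) L)"
  have w: "weighted_points ps"
    using Cons.prems(2)[of a ps] p by simp
  have IH: "weighted_points ((qs @ [(a, cc ps)]) @ ?c)"
    "cc ((qs @ [(a, cc ps)]) @ ?c) = cc (qs @ map (\<lambda>(a, ps). (a, cc ps)) (p # L))"
    using Cons.IH[of "qs @ [(a, cc ps)]"] Cons.prems by (auto simp: p)
  have w1: "weighted_points ((qs @ ?c) @ [(a, cc ps)])"
    using IH(1) weighted_points_mset[of "(qs @ ?c) @ [(a, cc ps)]" "(qs @ [(a, cc ps)]) @ ?c"] by simp
  have w2: "weighted_points ((qs @ ?c) @ map (\<lambda>(b, u). (a * b, u)) ps)"
    by (rule weighted_points_append_scaled[OF w1 w])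
  have "cc (qs @ map (\<lambda>(b, u). (a * b, u)) ps @ ?c) = cc ((qs @ ?c) @ map (\<lambda>(b, u). (a * b, u)) ps)"
    by (rule cc_mset[OF w2]) simp
  also have "\<dots> = cc ((qs @ ?c) @ [(a, cc ps)])"
    by (rule cc_merge_scaled[OF w w1])
  also have "\<dots> = cc ((qs @ [(a, cc ps)]) @ ?c)"
    by (rule cc_mset[OF IH(1)]) simp
  finally have "cc (qs @ map (\<lambda>(b, u). (a * b, u)) ps @ ?c) = cc (qs @ map (\<lambda>(a, ps). (a, cc ps)) (p # L))"
    using IH(2) by simp
  moreover have "weighted_points (qs @ map (\<lambda>(b, u). (a * b, u)) ps @ ?c)"
    using w2 weighted_points_mset[of "(qs @ ?c) @ map (\<lambda>(b, u). (a * b, u)) ps" "qs @ map (\<lambda>(b, u). (a * b, u)) ps @ ?c"]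
    by simp
  ultimately show ?case
    by (simp add: p)
qed

text \<open>The point \<open>x\<close> is a dummy: \<open>weighted_points\<close> reads the weights only.\<close>

lemma cc_flatten:
  assumes "weighted_points (map (\<lambda>i. (a i, x)) xs)"
    "\<And>i. i \<in> set xs \<Longrightarrow> weighted_points (ps i)"
  shows "cc (concat (map (\<lambda>i. map (\<lambda>(b, u). (a i * b, u)) (ps i)) xs)) =
    cc (map (\<lambda>i. (a i, cc (ps i))) xs)"
    and "weighted_points (concat (map (\<lambda>i. map (\<lambda>(b, u). (a i * b, u)) (ps i)) xs))"
proof -
  have "weighted_points (map (\<lambda>i. (a i, cc (ps i))) xs)"
    using assms(1) weighted_points_cong[of "map (\<lambda>i. (a i, cc (ps i))) xs" "map (\<lambda>i. (a i, x)) xs"]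
    by (simp add: o_def)
  then show "cc (concat (map (\<lambda>i. map (\<lambda>(b, u). (a i * b, u)) (ps i)) xs)) =
    cc (map (\<lambda>i. (a i, cc (ps i))) xs)"
    and "weighted_points (concat (map (\<lambda>i. map (\<lambda>(b, u). (a i * b, u)) (ps i)) xs))"
    using cc_flatten_append[of "[]" "map (\<lambda>i. (a i, ps i)) xs"] assms(2)
    by (auto simp: o_def)
qed

text \<open>Splitting off the head and renormalising the rest reduces combinations of many points to
  those of two, for which (CC.iv) is stated.\<close>

lemma cc_Cons:
  assumes "weighted_points ((a, u) # ps)" "ps \<noteq> []"
  shows "a < 1" "0 < a"
    "weighted_points (map (\<lambda>(b, v). (b / (1 - a), v)) ps)"
    "cc ((a, u) # ps) = cc [(a, u), (1 - a, cc (map (\<lambda>(b, v). (b / (1 - a), v)) ps))]"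
proof -
  let ?qs = "map (\<lambda>(b, v). (b / (1 - a), v)) ps"
  have s: "sum_list (map fst ps) = 1 - a" and pos: "\<forall>p\<in>set ps. 0 < fst p"
    using assms by (auto simp: weighted_points_def)
  obtain p ps' where ps: "ps = p # ps'"
    using assms(2) by (cases ps) auto
  have "0 \<le> sum_list (map fst ps')"
    using pos by (intro sum_list_nonneg) (auto simp: ps intro: less_imp_le)
  then have "0 < sum_list (map fst ps)"
    using pos by (simp add: ps add_pos_nonneg)
  then show a: "a < 1" "0 < a"
    using s assms(1) by (auto simp: weighted_points_def)
  have "sum_list (map fst ?qs) = inverse (1 - a) * sum_list (map fst ps)"
    by (simp add: sum_list_const_mult[symmetric] o_def case_prod_beta divide_inverse mult.commute)
  then show w: "weighted_points ?qs"
    using a s pos assms(2) by (auto simp: weighted_points_def)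
  have "map (\<lambda>(b, v). ((1 - a) * b, v)) ?qs = ps"
    using a by (auto simp: o_def case_prod_beta intro: map_idI)
  then show "cc ((a, u) # ps) = cc [(a, u), (1 - a, cc ?qs)]"
    using cc_merge_scaled[OF w, of "[(a, u)]" "1 - a" u] a by (simp add: weighted_points_def)
qed

text \<open>(CC.iv) is iterated along \<open>cc_Cons\<close>. The weights are generalised in the
  induction because the tail carries renormalised ones.\<close>

lemma dist_cc_le:
  assumes "weighted_points (map (\<lambda>i. (a i, f i)) xs)"
  shows "dist (cc (map (\<lambda>i. (a i, f i)) xs)) (cc (map (\<lambda>i. (a i, g i)) xs)) \<le>
    (\<Sum>i\<leftarrow>xs. a i * dist (f i) (g i))"
  using assms
proof (induction xs arbitrary: a)
  case Nil
  then show ?case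
    by (simp add: weighted_points_def)
next
  case (Cons i xs)
  show ?case
  proof (cases "xs = []")
    case True
    then have "a i = 1"
      using Cons.prems by (simp add: weighted_points_def)
    then show ?thesis
      by (simp add: True cc_single)
  next
    case False
    define b where "b j = a j / (1 - a i)" for j
    have w: "weighted_points ((a i, h i) # map (\<lambda>j. (a j, h j)) xs)" for h
      using Cons.prems weighted_points_cong[of "map (\<lambda>i. (a i, f i)) (i # xs)" "map (\<lambda>i. (a i, h i)) (i # xs)"]
      by (simp add: o_def)
    note F = cc_Cons[OF w[of f]] and G = cc_Cons[OF w[of g]]
    have b: "map (\<lambda>(b, v). (b / (1 - a i), v)) (map (\<lambda>j. (a j, h j)) xs) = map (\<lambda>j. (b j, h j)) xs" for h :: "_ \<Rightarrow> 'a"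
      by (simp add: b_def o_def)
    have a: "0 < a i" "a i < 1"
      using F False by auto
    have "dist (cc (map (\<lambda>i. (a i, f i)) (i # xs))) (cc (map (\<lambda>i. (a i, g i)) (i # xs))) \<le>
        a i * dist (f i) (g i) + (1 - a i) *
          dist (cc (map (\<lambda>j. (b j, f j)) xs)) (cc (map (\<lambda>j. (b j, g j)) xs))"
      using F(4)[unfolded b] G(4)[unfolded b] False cc_dist_le[OF a] by simp
    also have "\<dots> \<le> a i * dist (f i) (g i) + (1 - a i) * (\<Sum>j\<leftarrow>xs. b j * dist (f j) (g j))"
      using a F(3)[unfolded b] False by (intro add_left_mono mult_left_mono Cons.IH) auto
    also have "(1 - a i) * (\<Sum>j\<leftarrow>xs. b j * dist (f j) (g j)) = (\<Sum>j\<leftarrow>xs. a j * dist (f j) (g j))"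
      using a by (simp add: b_def sum_list_const_mult[symmetric])
    finally show ?thesis
      by simp
  qed
qed

end

section \<open>Convexification\<close>

lemma weighted_points_pair:
  "weighted_points [(a, u), (b, v)] \<longleftrightarrow> 0 < a \<and> 0 < b \<and> a + b = 1"
  by (auto simp: weighted_points_def)

lemma weighted_points_replicate: "0 < n \<Longrightarrow> weighted_points (replicate n (1 / real n, u))"
  by (auto simp: weighted_points_def sum_list_replicate)

context cc_space
begin

text \<open>Here \<open>n\<close> counts the points, whereas the index in the definition of
  \<open>K\<close> is shifted by one; \<open>average 0 u\<close> is unconstrained.\<close>

definition average :: "nat \<Rightarrow> 'a \<Rightarrow> 'a" where
  "average n u = cc (replicate n (1 / real n, u))"

lemma average_tendsto: "(\<lambda>n. average n u) \<longlonglongrightarrow> K u"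
proof -
  have "(\<lambda>n. average (Suc n) u) \<longlonglongrightarrow> K u"
    using cc_average_convergent[of u]
    unfolding convergent_LIMSEQ_iff convexification_def average_def .
  then show ?thesis
    by (rule LIMSEQ_imp_Suc)
qed

text \<open>Flattening gives \<open>n + m\<close> copies of \<open>u\<close>, each of weight
  \<open>1 / (n + m)\<close>.\<close>

lemma average_add:
  assumes "0 < n" "0 < m"
  shows "cc [(real n / real (n + m), average n u), (real m / real (n + m), average m u)] = average (n + m) u"
proof -
  have eq: "real n / (real n + real m) + real m / (real n + real m) = 1"
    using assms by (simp add: add_divide_distrib[symmetric])
  have "cc (concat (map (\<lambda>i. map (\<lambda>(b, u). (real i / real (n + m) * b, u)) (replicate i (1 / real i, u))) [n, m])) =
    cc (map (\<lambda>i. (real i / real (n + m), cc (replicate i (1 / real i, u)))) [n, m])"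
    using assms eq by (intro cc_flatten(1)[where x = u]) (auto simp: weighted_points_pair weighted_points_replicate)
  then show ?thesis
    using assms by (simp add: average_def replicate_add)
qed

text \<open>(CC.iii) moves the weight for fixed points and (CC.iv) moves the points for a fixed
  weight; together they give joint continuity.\<close>

lemma cc_pair_tendsto:
  assumes "\<And>k. 0 < l k" "\<And>k. l k < 1" "l \<longlonglongrightarrow> t" "0 < t" "t < 1"
    and "x \<longlonglongrightarrow> a" "y \<longlonglongrightarrow> b"
  shows "(\<lambda>k. cc [(l k, x k), (1 - l k, y k)]) \<longlonglongrightarrow> cc [(t, a), (1 - t, b)]"
proof -
  let ?g = "\<lambda>k. dist (x k) a + dist (y k) b + dist (cc [(l k, a), (1 - l k, b)]) (cc [(t, a), (1 - t, b)])"
  have "dist (cc [(l k, x k), (1 - l k, y k)]) (cc [(t, a), (1 - t, b)]) \<le> ?g k" for k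
  proof -
    have "dist (cc [(l k, x k), (1 - l k, y k)]) (cc [(l k, a), (1 - l k, b)])
        \<le> l k * dist (x k) a + (1 - l k) * dist (y k) b"
      using assms by (intro cc_dist_le)
    also have "\<dots> \<le> dist (x k) a + dist (y k) b"
      using assms(1,2)[of k] by (intro add_mono) (auto intro!: mult_left_le_one_le)
    finally show ?thesis
      using dist_triangle[of "cc [(l k, x k), (1 - l k, y k)]" "cc [(t, a), (1 - t, b)]" "cc [(l k, a), (1 - l k, b)]"]
      by linarith
  qed
  moreover have "(\<lambda>k. cc [(l k, a), (1 - l k, b)]) \<longlonglongrightarrow> cc [(t, a), (1 - t, b)]"
    using assms by (intro cc_weight_continuous) auto
  then have "?g \<longlonglongrightarrow> 0 + 0 + 0"
    using assms(6,7) by (intro tendsto_add) (auto simp: tendsto_dist_iff[symmetric])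
  ultimately show ?thesis
    by (subst tendsto_dist_iff) (rule tendsto_0_le[where K = 1 and f = ?g], auto)
qed

text \<open>
  Averages over \<open>k + 2\<close> points split into averages over \<open>n k\<close> and \<open>m k\<close> points with relative
  weights tending to \<open>t\<close> and \<open>1 - t\<close>.
\<close>

lemma cc_K_self:
  assumes "0 < t" "t < 1"
  shows "cc [(t, K u), (1 - t, K u)] = K u"
proof -
  \<comment> \<open>Since \<open>\<lfloor>t * k\<rfloor> \<le> k\<close>, the successor here and the
    total \<open>k + 2\<close> leave at least one point on each side for every
    \<open>k\<close>.\<close>
  define n where "n k = Suc (nat \<lfloor>t * real k\<rfloor>)" for k
  define m where "m k = k + 2 - n k" for k
  have floor: "real (nat \<lfloor>t * real k\<rfloor>) \<le> t * real k" "t * real k < real (nat \<lfloor>t * real k\<rfloor>) + 1" for k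
    using assms by (auto simp: of_nat_nat)
  have tk: "t * real k \<le> real k" for k
    using assms by (simp add: mult_left_le_one_le)
  have "real (nat \<lfloor>t * real k\<rfloor>) \<le> real k" for k
    using floor(1)[of k] tk[of k] by linarith
  then have "nat \<lfloor>t * real k\<rfloor> \<le> k" for k
    by simp
  then have nk: "n k + m k = k + 2" "0 < n k" "0 < m k" for k
    using le_imp_less_Suc[of "nat \<lfloor>t * real k\<rfloor>" k] by (simp_all add: n_def m_def)
  have n: "t * real k \<le> real (n k)" "real (n k) \<le> t * real k + 1" for k
    unfolding n_def of_nat_Suc using floor[of k] by linarith+
  have m: "(1 - t) * real k \<le> real (m k)" for k
    using n(2)[of k] nk(1)[of k] by (simp add: algebra_simps flip: of_nat_add)
  have top: "filterlim (\<lambda>k. c * real k) at_top sequentially" if "0 < c" for c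
    using that by (intro filterlim_tendsto_pos_mult_at_top[OF tendsto_const] filterlim_real_sequentially)
  have lim_n: "filterlim n sequentially sequentially"
    unfolding filterlim_sequentially_iff_filterlim_real
    using filterlim_at_top_mono[OF top[OF assms(1)]] n(1) by simp
  have lim_m: "filterlim m sequentially sequentially"
    unfolding filterlim_sequentially_iff_filterlim_real
    using filterlim_at_top_mono[OF top[of "1 - t"]] m assms(2) by simp
  have lim: "(\<lambda>k. real (n k) / real (k + 2)) \<longlonglongrightarrow> t"
  proof -
    \<comment> \<open>From \<open>t * k \<le> n k \<le> t * k + 1\<close> the error against
      \<open>t * (k + 2)\<close> is at most 2.\<close>
    have bound: "norm (real (n k) / real (k + 2) - t) \<le> norm (inverse (real (Suc k))) * 2" for k
    proof -
      have "\<bar>real (n k) - t * real (k + 2)\<bar> \<le> 2"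
        using n[of k] assms by (simp add: algebra_simps abs_le_iff)
      then have "\<bar>real (n k) - t * real (k + 2)\<bar> / real (k + 2) \<le> 2 / real (k + 2)"
        by (rule divide_right_mono) simp
      also have "\<dots> \<le> 2 / real (Suc k)"
        by (intro divide_left_mono) auto
      also have "\<bar>real (n k) - t * real (k + 2)\<bar> / real (k + 2) = \<bar>real (n k) / real (k + 2) - t\<bar>"
      proof -
        have "real (n k) / real (k + 2) - t = (real (n k) - t * real (k + 2)) / real (k + 2)"
          by (simp add: field_simps)
        then show ?thesis
          by (simp only: abs_divide abs_of_nat)
      qed
      finally show ?thesis
        by (simp add: divide_inverse mult.commute)
    qed
    show ?thesis
      by (rule LIM_zero_cancel[OF tendsto_0_le[OF LIMSEQ_inverse_real_of_nat always_eventually[OF allI[OF bound]]]])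
  qed
  have eq: "real (m k) / real (k + 2) = 1 - real (n k) / real (k + 2)" for k
    using nk(1)[of k] by (simp add: field_simps flip: of_nat_add)
  have "(\<lambda>k. cc [(real (n k) / real (k + 2), average (n k) u), (1 - real (n k) / real (k + 2), average (m k) u)])
      \<longlonglongrightarrow> cc [(t, K u), (1 - t, K u)]"
  proof (rule cc_pair_tendsto[OF _ _ lim assms])
    show "0 < real (n k) / real (k + 2)" "real (n k) / real (k + 2) < 1" for k
      using nk[of k] by auto
  qed (use filterlim_compose[OF average_tendsto lim_n] filterlim_compose[OF average_tendsto lim_m] in \<open>auto simp: o_def\<close>)
  moreover have "cc [(real (n k) / real (k + 2), average (n k) u), (1 - real (n k) / real (k + 2), average (m k) u)]
      = average (k + 2) u" for k
    using average_add[OF nk(2,3)[of k], of u] nk(1)[of k] eq[of k] by simp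
  moreover have "(\<lambda>k. average (k + 2) u) \<longlonglongrightarrow> K u"
    using average_tendsto by (rule LIMSEQ_ignore_initial_segment)
  ultimately show ?thesis
    using LIMSEQ_unique by fastforce
qed

text \<open>A list of \<open>n + 2\<close> equal points splits into \<open>n + 1\<close> and one, so
  by induction every average of \<open>x\<close> is \<open>x\<close>, and so is the limit.\<close>

lemma K_eqI:
  assumes "\<And>t. 0 < t \<Longrightarrow> t < 1 \<Longrightarrow> cc [(t, x), (1 - t, x)] = x"
  shows "K x = x"
proof -
  have "average (Suc n) x = x" for n
  proof (induction n)
    case 0
    then show ?case by (simp add: average_def cc_single)
  next
    case (Suc n)
    have "1 / (2 + real n) = 1 - (1 + real n) / (2 + real n)"
      by (simp add: field_simps)
    then show ?case
      using average_add[of "Suc n" 1 x] Suc assms[of "(1 + real n) / (2 + real n)"]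
      by (simp add: average_def cc_single add_ac)
  qed
  then have "(\<lambda>n. average n x) \<longlonglongrightarrow> x"
    by (subst filterlim_sequentially_Suc[symmetric]) simp
  then show ?thesis
    using average_tendsto LIMSEQ_unique by blast
qed

lemma K_idem [simp]: "K (K u) = K u"
  using cc_K_self by (intro K_eqI)

lemma cc_pair_self:
  assumes "K x = x" "0 < a" "0 < b"
  shows "cc [(a / (a + b), x), (b / (a + b), x)] = x"
proof -
  have "b / (a + b) = 1 - a / (a + b)"
    using assms by (simp add: field_simps)
  then show ?thesis
    using cc_K_self[of "a / (a + b)" x] assms by simp
qed

lemma dist_K_le: "dist (K u) (K v) \<le> dist u v"
proof (rule tendsto_upperbound)
  show "(\<lambda>n. dist (average n u) (average n v)) \<longlonglongrightarrow> dist (K u) (K v)"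
    by (intro tendsto_dist average_tendsto)
  have "dist (average n u) (average n v) \<le> dist u v" if "0 < n" for n
    \<comment> \<open>All entries carry the same weight and point, so a list of \<open>n\<close>
      unit values serves as index list.\<close>
    using dist_cc_le[of "\<lambda>_. 1 / real n" "\<lambda>_. u" "replicate n ()" "\<lambda>_. v"] that weighted_points_replicate[OF that, of u]
    by (simp add: average_def sum_list_replicate)
  then show "\<forall>\<^sub>F n in sequentially. dist (average n u) (average n v) \<le> dist u v"
    by (intro eventually_mono[OF eventually_gt_at_top[of 0]])
qed simp

text \<open>The average of \<open>n\<close> copies of the pair and the pair of the two averages
  flatten to the same \<open>2 * n\<close> entries; joint continuity carries the identity to the
  limit.\<close>

lemma K_cc_pair:
  assumes "0 < t" "t < 1"
  shows "K (cc [(t, u), (1 - t, v)]) = cc [(t, K u), (1 - t, K v)]"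
proof -
  have "average n (cc [(t, u), (1 - t, v)]) = cc [(t, average n u), (1 - t, average n v)]" if n: "0 < n" for n
  proof -
    let ?ps = "\<lambda>x. if x then replicate n (1 / real n, u) else replicate n (1 / real n, v)"
    let ?a = "\<lambda>x. if x then t else 1 - t"
    let ?l = "concat (map (\<lambda>i::nat. map (\<lambda>(b, u). (1 / real n * b, u)) [(t, u), (1 - t, v)]) [0..<n])"
    let ?r = "concat (map (\<lambda>i. map (\<lambda>(b, u). (?a i * b, u)) (?ps i)) [True, False])"
    have mset: "mset (concat (map (\<lambda>i::nat. [x, y]) [0..<n])) = mset (replicate n x) + mset (replicate n y)" for x y :: "real \<times> 'a"
      by (induction n) auto
    have w: "weighted_points (map (\<lambda>i. (?a i, u)) [True, False])"
      using assms by (simp add: weighted_points_pair)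
    have 1: "cc ?r = cc (map (\<lambda>i. (?a i, cc (?ps i))) [True, False])" "weighted_points ?r"
      using n by (intro cc_flatten[OF w]; auto simp: weighted_points_replicate)+
    have 2: "cc ?l = cc (map (\<lambda>i. (1 / real n, cc [(t, u), (1 - t, v)])) [0..<n])"
    proof (rule cc_flatten)
      show "weighted_points (map (\<lambda>i. (1 / real n, u)) [0..<n])"
        using weighted_points_replicate[OF n, of u] by (simp add: map_replicate_const)
    qed (use assms in \<open>simp add: weighted_points_pair\<close>)
    have "cc ?l = cc ?r"
    proof (rule cc_mset[OF 1(2)])
      show "mset ?l = mset ?r"
        by (simp add: mset)
    qed
    then show ?thesis
      using 1(1) 2 by (simp add: average_def map_replicate_const)
  qed
  then have "\<forall>\<^sub>F n in sequentially. cc [(t, average n u), (1 - t, average n v)] = average n (cc [(t, u), (1 - t, v)])"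
    by (intro eventually_mono[OF eventually_gt_at_top[of 0]]) simp
  moreover have "(\<lambda>n. cc [(t, average n u), (1 - t, average n v)]) \<longlonglongrightarrow> cc [(t, K u), (1 - t, K v)]"
    using assms by (intro cc_pair_tendsto average_tendsto) auto
  ultimately have "(\<lambda>n. average n (cc [(t, u), (1 - t, v)])) \<longlonglongrightarrow> cc [(t, K u), (1 - t, K v)]"
    using tendsto_cong by fast
  then show ?thesis
    using average_tendsto LIMSEQ_unique by blast
qed

end

section \<open>Barycentres of finitely supported laws\<close>

lemma weighted_points_pmf:
  assumes "distinct xs" "set xs = set_pmf p"
  shows "weighted_points (map (\<lambda>i. (pmf p i, f i)) xs)"
proof -
  have "finite (set_pmf p)"
    using assms(2) by (metis finite_set)
  then have "(\<Sum>i\<leftarrow>xs. pmf p i) = 1"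
    using assms by (simp add: sum_list_distinct_conv_sum_set sum_pmf_eq_1)
  then show ?thesis
    using assms(2) by (auto simp: weighted_points_def o_def set_pmf_not_empty pmf_positive)
qed

text \<open>The law of a list that may repeat points. It makes such lists comparable with a pmf,
  whose enumerations have no repetitions.\<close>

definition list_mass :: "(real \<times> 'i) list \<Rightarrow> 'i \<Rightarrow> real" where
  "list_mass ps j = (\<Sum>(a, i)\<leftarrow>ps. if i = j then a else 0)"

lemma list_mass_simps [simp]:
  "list_mass [] j = 0"
  "list_mass ((a, i) # ps) j = (if i = j then a else 0) + list_mass ps j"
  "list_mass (ps @ qs) j = list_mass ps j + list_mass qs j"
  by (simp_all add: list_mass_def)

lemma list_mass_concat: "list_mass (concat pss) j = (\<Sum>ps\<leftarrow>pss. list_mass ps j)"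
  by (induction pss) simp_all

lemma list_mass_eq_0: "j \<notin> snd ` set ps \<Longrightarrow> list_mass ps j = 0"
  by (induction ps) auto

lemma list_mass_distinct:
  assumes "distinct (map snd ps)" "(a, j) \<in> set ps"
  shows "list_mass ps j = a"
  using assms
proof (induction ps)
  case (Cons p ps)
  then show ?case
    by (cases p) (force intro: list_mass_eq_0)
qed simp

text \<open>The factor \<open>c\<close> is the weight of an outer entry whose block is expanded in
  place.\<close>

lemma list_mass_pmf:
  assumes "distinct xs" "set xs = set_pmf p"
  shows "list_mass (map (\<lambda>i. (c * pmf p i, i)) xs) j = c * pmf p j"
proof (cases "j \<in> set_pmf p")
  case True
  then show ?thesis
    using assms by (intro list_mass_distinct) (auto simp: o_def)
next
  case False
  then show ?thesis
    using assms by (subst list_mass_eq_0) (auto simp: set_pmf_iff)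
qed

text \<open>A law on the booleans is determined by its mass at \<open>True\<close>, which for the
  mixture is the mean of the parameters. The strict bounds make this mean an admissible
  weight.\<close>

lemma bind_bernoulli_pmf:
  assumes "\<And>t. t \<in> set_pmf q \<Longrightarrow> 0 < t \<and> t < 1"
  shows "bind_pmf q bernoulli_pmf = bernoulli_pmf (measure_pmf.expectation q (\<lambda>t. t))" (is "_ = bernoulli_pmf ?e")
    and "0 < measure_pmf.expectation q (\<lambda>t. t)" "measure_pmf.expectation q (\<lambda>t. t) < 1"
proof -
  have int: "integrable (measure_pmf q) (\<lambda>t. t)"
    by (rule measure_pmf.integrable_const_bound[where B = 1]) (auto simp: AE_measure_pmf_iff dest!: assms)
  obtain t0 where t0: "t0 \<in> set_pmf q"
    using set_pmf_not_empty by fast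
  \<comment> \<open>To be applied to \<open>t\<close> and to \<open>1 - t\<close>: a nonnegative
    function of mean zero would vanish on the nonempty support.\<close>
  have pos: "0 < measure_pmf.expectation q f" if "integrable (measure_pmf q) f" "\<And>t. t \<in> set_pmf q \<Longrightarrow> 0 < f t" for f :: "real \<Rightarrow> real"
  proof -
    have "measure_pmf.expectation q f \<noteq> 0"
      using integral_nonneg_eq_0_iff_AE[OF that(1)] that(2) t0
      by (auto simp: AE_measure_pmf_iff less_imp_le dest: order.strict_implies_not_eq)
    moreover have "0 \<le> measure_pmf.expectation q f"
      using that(2) by (intro integral_nonneg_AE) (auto simp: AE_measure_pmf_iff less_imp_le)
    ultimately show ?thesis
      by simp
  qed
  show e0: "0 < ?e"
    using assms int by (intro pos) auto
  have "0 < measure_pmf.expectation q (\<lambda>t. 1 - t)"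
    using assms int by (intro pos) auto
  then show e1: "?e < 1"
    using int by simp
  have "pmf (bind_pmf q bernoulli_pmf) True = ?e"
    unfolding pmf_bind using assms
    by (intro integral_cong_AE) (auto simp: AE_measure_pmf_iff less_imp_le)
  moreover have "pmf (bind_pmf q bernoulli_pmf) False = measure_pmf.expectation q (\<lambda>t. 1 - t)"
    unfolding pmf_bind using assms
    by (intro integral_cong_AE) (auto simp: AE_measure_pmf_iff less_imp_le)
  ultimately have "pmf (bind_pmf q bernoulli_pmf) b = pmf (bernoulli_pmf ?e) b" for b
    using e0 e1 int by (cases b) simp_all
  then show "bind_pmf q bernoulli_pmf = bernoulli_pmf ?e"
    by (rule pmf_eqI)
qed

context cc_space
begin

text \<open>
  Only meaningful for finite support: otherwise no list enumerates \<open>set_pmf p\<close> and \<open>SOME\<close>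
  chooses from an empty predicate.
\<close>

definition bary :: "'i pmf \<Rightarrow> ('i \<Rightarrow> 'a) \<Rightarrow> 'a" where
  "bary p f = cc (map (\<lambda>i. (pmf p i, f i)) (SOME xs. distinct xs \<and> set xs = set_pmf p))"

lemma bary_enum:
  assumes "distinct xs" "set xs = set_pmf p"
  shows "bary p f = cc (map (\<lambda>i. (pmf p i, f i)) xs)"
proof -
  define ys where "ys = (SOME xs. distinct xs \<and> set xs = set_pmf p)"
  have "distinct ys \<and> set ys = set_pmf p"
    unfolding ys_def by (rule someI[of _ xs]) (use assms in simp)
  then have "mset ys = mset xs"
    using assms set_eq_iff_mset_eq_distinct by metis
  then show ?thesis
    unfolding bary_def ys_def[symmetric]
    by (intro cc_mset weighted_points_pmf assms) simp
qed

lemma bary_cong: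
  assumes "finite (set_pmf p)" "\<And>i. i \<in> set_pmf p \<Longrightarrow> f i = g i"
  shows "bary p f = bary p g"
proof -
  obtain xs where xs: "distinct xs" "set xs = set_pmf p"
    using finite_distinct_list[OF assms(1)] by auto
  then have "map (\<lambda>i. (pmf p i, f i)) xs = map (\<lambda>i. (pmf p i, g i)) xs"
    using assms(2) by simp
  then show ?thesis
    using bary_enum[OF xs] by metis
qed

lemma dist_bary_le:
  assumes "finite (set_pmf p)"
  shows "dist (bary p f) (bary p g) \<le> measure_pmf.expectation p (\<lambda>i. dist (f i) (g i))"
proof -
  obtain xs where xs: "distinct xs" "set xs = set_pmf p"
    using finite_distinct_list[OF assms(1)] by auto
  have "measure_pmf.expectation p (\<lambda>i. dist (f i) (g i)) = (\<Sum>i\<leftarrow>xs. pmf p i * dist (f i) (g i))"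
    using assms xs by (subst integral_measure_pmf[of "set_pmf p"]) (auto simp: sum_list_distinct_conv_sum_set)
  then show ?thesis
    unfolding bary_enum[OF xs] using dist_cc_le[OF weighted_points_pmf[OF xs]] by metis
qed

lemma bary_return: "bary (return_pmf i) f = f i"
  by (subst bary_enum[of "[i]"]) (auto simp: cc_single)

lemma bary_bernoulli:
  assumes "0 < t" "t < 1"
  shows "bary (bernoulli_pmf t) f = cc [(t, f True), (1 - t, f False)]"
  using assms by (subst bary_enum[of "[True, False]"]) (auto simp: set_pmf_bernoulli)

text \<open>Repeated points merge by \<open>cc_pair_self\<close>, which needs them to be fixed points of \<open>K\<close>.\<close>

lemma bary_eq_cc:
  assumes "weighted_points ps" "\<And>a i. (a, i) \<in> set ps \<Longrightarrow> K (f i) = f i" "\<And>i. pmf p i = list_mass ps i"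
  shows "bary p f = cc (map (apsnd f) ps)"
  using assms
proof (induction ps rule: length_induct)
  case (1 ps)
  show ?case
  proof (cases "distinct (map snd ps)")
    \<comment> \<open>Without repetitions each weight is the mass of its index, so positivity of the
      weights makes the list an enumeration of the support.\<close>
    case True
    have pmf: "pmf p i = a" if "(a, i) \<in> set ps" for a i
      using that True 1(4) by (simp add: list_mass_distinct)
    have "0 < a" if "(a, i) \<in> set ps" for a i
      using that 1(2) by (auto simp: weighted_points_def)
    then have "set (map snd ps) = set_pmf p"
      using pmf list_mass_eq_0[of _ ps] 1(4) by (force simp: set_pmf_iff)
    then have "bary p f = cc (map (\<lambda>i. (pmf p i, f i)) (map snd ps))"
      by (rule bary_enum[OF True])
    also have "map (\<lambda>i. (pmf p i, f i)) (map snd ps) = map (apsnd f) ps"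
      using pmf by auto
    finally show ?thesis .
  next
    case False
    then obtain as bs cs x where dec: "map snd ps = as @ [x] @ bs @ [x] @ cs"
      using not_distinct_decomp by blast
    have split: "\<exists>us a vs. qs = us @ (a, x) # vs \<and> map snd vs = ys"
      if "map snd qs = xs @ x # ys" for qs :: "(real \<times> 'b) list" and xs ys
    proof -
      obtain us vs' where "qs = us @ vs'" "map snd vs' = x # ys"
        using \<open>map snd qs = xs @ x # ys\<close> by (metis map_eq_append_conv)
      moreover then obtain a vs where "vs' = (a, x) # vs" "map snd vs = ys"
        by (cases vs') auto
      ultimately show ?thesis
        by blast
    qed
    have "map snd ps = as @ x # (bs @ x # cs)"
      using dec by simp
    from split[OF this] obtain as' a zs where "ps = as' @ (a, x) # zs" and zs: "map snd zs = bs @ x # cs"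
      by blast
    moreover obtain bs' b cs' where "zs = bs' @ (b, x) # cs'"
      using split[OF zs] by blast
    ultimately have ps: "ps = as' @ [(a, x)] @ bs' @ [(b, x)] @ cs'"
      by simp
    \<comment> \<open>Moving both entries of \<open>x\<close> to the end and adding their weights
      preserves \<open>list_mass\<close> and shortens the list, so the induction hypothesis
      applies.\<close>
    define qs where "qs = as' @ bs' @ cs'"
    let ?qs = "qs @ [(a + b, x)]"
    have ab: "0 < a" "0 < b"
      using 1(2) by (auto simp: ps weighted_points_def)
    have w: "weighted_points ?qs"
      using 1(2) by (auto simp: ps qs_def weighted_points_def)
    have wf: "weighted_points (map (apsnd f) qs @ [(a, f x), (b, f x)])"
      using w ab by (auto simp: weighted_points_def o_def)
    have x: "K (f x) = f x"
      using 1(3) by (auto simp: ps)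
    have IH: "bary p f = cc (map (apsnd f) ?qs)"
    proof (rule 1(1)[rule_format, OF _ w])
      show "K (f i) = f i" if "(a, i) \<in> set ?qs" for a i
        using that 1(3) x by (auto simp: ps qs_def)
      show "pmf p i = list_mass ?qs i" for i
        using 1(4)[of i] by (simp add: ps qs_def)
    qed (simp add: ps qs_def)
    have "cc (map (apsnd f) ps) = cc (map (apsnd f) qs @ [(a, f x), (b, f x)])"
      by (rule cc_mset[OF wf]) (simp add: ps qs_def)
    also have "\<dots> = cc (map (apsnd f) ?qs)"
      using cc_merge[OF wf] cc_pair_self[OF x ab] by simp
    finally show ?thesis
      using IH by simp
  qed
qed

text \<open>When the supports of the laws \<open>q i\<close> overlap, the flattened list repeats
  indices; its evaluation as a barycentre therefore calls for points fixed by
  \<open>K\<close>.\<close>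

lemma bary_bind:
  assumes "finite (set_pmf p)" "\<And>i. i \<in> set_pmf p \<Longrightarrow> finite (set_pmf (q i))"
    and "\<And>i j. i \<in> set_pmf p \<Longrightarrow> j \<in> set_pmf (q i) \<Longrightarrow> K (f j) = f j"
  shows "bary (bind_pmf p q) f = bary p (\<lambda>i. bary (q i) f)"
proof -
  obtain xs where xs: "distinct xs" "set xs = set_pmf p"
    using finite_distinct_list[OF assms(1)] by auto
  have "\<forall>i\<in>set_pmf p. \<exists>ys. distinct ys \<and> set ys = set_pmf (q i)"
    using finite_distinct_list assms(2) by metis
  then obtain ys where ys: "\<And>i. i \<in> set_pmf p \<Longrightarrow> distinct (ys i)" "\<And>i. i \<in> set_pmf p \<Longrightarrow> set (ys i) = set_pmf (q i)"
    by metis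
  define L where "L = concat (map (\<lambda>i. map (\<lambda>j. (pmf p i * pmf (q i) j, j)) (ys i)) xs)"
  have L: "map (apsnd f) L = concat (map (\<lambda>i. map (\<lambda>(b, u). (pmf p i * b, u)) (map (\<lambda>j. (pmf (q i) j, f j)) (ys i))) xs)"
    by (simp add: L_def map_concat o_def)
  have w: "weighted_points (map (\<lambda>i. (pmf p i, undefined)) xs)"
    by (rule weighted_points_pmf[OF xs])
  have *: "cc (map (apsnd f) L) = cc (map (\<lambda>i. (pmf p i, cc (map (\<lambda>j. (pmf (q i) j, f j)) (ys i)))) xs)"
    "weighted_points (map (apsnd f) L)"
    unfolding L using xs ys by (intro cc_flatten[OF w] weighted_points_pmf; simp)+
  have "bary (bind_pmf p q) f = cc (map (apsnd f) L)"
  proof (rule bary_eq_cc)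
    show "weighted_points L"
      using *(2) weighted_points_cong[of L "map (apsnd f) L"] by (simp add: o_def)
    show "K (f i) = f i" if "(a, i) \<in> set L" for a i
      using that assms(3) xs ys by (auto simp: L_def)
    show "pmf (bind_pmf p q) j = list_mass L j" for j
    proof -
      have "list_mass L j = (\<Sum>i\<leftarrow>xs. list_mass (map (\<lambda>j. (pmf p i * pmf (q i) j, j)) (ys i)) j)"
        by (simp add: L_def list_mass_concat o_def)
      also have "\<dots> = (\<Sum>i\<leftarrow>xs. pmf p i * pmf (q i) j)"
        using xs ys by (intro arg_cong[where f = sum_list] map_cong list_mass_pmf) auto
      also have "\<dots> = pmf (bind_pmf p q) j"
        unfolding pmf_bind using assms(1) xs
        by (subst integral_measure_pmf[of "set_pmf p"]) (auto simp: sum_list_distinct_conv_sum_set)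
      finally show ?thesis ..
    qed
  qed
  also have "\<dots> = cc (map (\<lambda>i. (pmf p i, bary (q i) f)) xs)"
    unfolding *(1) using xs ys
    by (intro arg_cong[where f = cc] map_cong refl) (simp add: bary_enum[OF ys])
  also have "\<dots> = bary p (\<lambda>i. bary (q i) f)"
    by (rule bary_enum[OF xs, symmetric])
  finally show ?thesis .
qed

text \<open>The case of Dirac laws in \<open>bary_bind\<close>: indices identified by
  \<open>g\<close> have their weights merged.\<close>

lemma bary_map:
  assumes "finite (set_pmf p)" "\<And>i. i \<in> set_pmf p \<Longrightarrow> K (f (g i)) = f (g i)"
  shows "bary (map_pmf g p) f = bary p (\<lambda>i. f (g i))"
  unfolding map_pmf_def using assms by (subst bary_bind) (auto simp: bary_return)

lemma bary_pair:
  assumes "finite (set_pmf p)" "finite (set_pmf q)"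
    and "\<And>i j. i \<in> set_pmf p \<Longrightarrow> j \<in> set_pmf q \<Longrightarrow> K (f i j) = f i j"
  shows "bary (pair_pmf p q) (\<lambda>(i, j). f i j) = bary p (\<lambda>i. bary q (f i))"
proof -
  have "bary (pair_pmf p q) (\<lambda>(i, j). f i j) = bary p (\<lambda>i. bary (map_pmf (Pair i) q) (\<lambda>(i, j). f i j))"
    unfolding pair_pmf_def map_pmf_def[symmetric] using assms by (subst bary_bind) auto
  also have "\<dots> = bary p (\<lambda>i. bary q (f i))"
    using assms by (intro bary_cong) (auto simp: bary_map)
  finally show ?thesis .
qed

text \<open>A discrete Fubini theorem: both sides are barycentres of a product law, which is
  symmetric under swapping its factors.\<close>

lemma bary_commute:
  assumes "finite (set_pmf p)" "finite (set_pmf q)"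
    and "\<And>i j. i \<in> set_pmf p \<Longrightarrow> j \<in> set_pmf q \<Longrightarrow> K (f i j) = f i j"
  shows "bary p (\<lambda>i. bary q (f i)) = bary q (\<lambda>j. bary p (\<lambda>i. f i j))"
proof -
  have "bary p (\<lambda>i. bary q (f i)) = bary (map_pmf (\<lambda>(j, i). (i, j)) (pair_pmf q p)) (\<lambda>(i, j). f i j)"
    using assms by (subst pair_commute_pmf[symmetric]) (simp add: bary_pair)
  also have "\<dots> = bary (pair_pmf q p) (\<lambda>(j, i). f i j)"
    using assms by (subst bary_map) (auto simp: case_prod_unfold)
  also have "\<dots> = bary q (\<lambda>j. bary p (\<lambda>i. f i j))"
    using assms by (intro bary_pair)
  finally show ?thesis .
qed

lemma bary_const: "finite (set_pmf p) \<Longrightarrow> K x = x \<Longrightarrow> bary p (\<lambda>i. x) = x"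
  using bary_map[of p "\<lambda>x. x" "\<lambda>_. x"] by (simp add: bary_return)

lemma bary_cc_pair:
  assumes "finite (set_pmf p)" "0 < t" "t < 1"
    and "\<And>i. i \<in> set_pmf p \<Longrightarrow> K (f i) = f i" "\<And>i. i \<in> set_pmf p \<Longrightarrow> K (g i) = g i"
  shows "bary p (\<lambda>i. cc [(t, f i), (1 - t, g i)]) = cc [(t, bary p f), (1 - t, bary p g)]"
proof -
  have "bary p (\<lambda>i. bary (bernoulli_pmf t) (\<lambda>b. if b then f i else g i)) =
      bary (bernoulli_pmf t) (\<lambda>b. bary p (\<lambda>i. if b then f i else g i))"
    using assms by (intro bary_commute) auto
  then show ?thesis
    using assms by (simp add: bary_bernoulli)
qed

text \<open>Under the product law one may average over \<open>t\<close> first with \<open>i\<close>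
  held fixed. This turns the random weight into the constant \<open>e\<close>, and constant weights
  commute with the remaining average.\<close>

lemma bary_random_weights:
  assumes "finite (set_pmf p)" "finite (set_pmf q)"
    and "\<And>t. t \<in> set_pmf q \<Longrightarrow> 0 < t \<and> t < 1"
    and "\<And>i. i \<in> set_pmf p \<Longrightarrow> K (f i) = f i" "K x = x"
  defines "e \<equiv> measure_pmf.expectation q (\<lambda>t. t)"
  shows "bary (pair_pmf q p) (\<lambda>(t, i). cc [(t, f i), (1 - t, x)]) = cc [(e, bary p f), (1 - e, x)]"
proof -
  note e = bind_bernoulli_pmf[where q = q, OF assms(3), folded e_def]
  have fixed: "K (cc [(t, f i), (1 - t, x)]) = cc [(t, f i), (1 - t, x)]" if "t \<in> set_pmf q" "i \<in> set_pmf p" for t i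
    using that assms by (simp add: K_cc_pair)
  have "bary (pair_pmf q p) (\<lambda>(t, i). cc [(t, f i), (1 - t, x)]) =
      bary p (\<lambda>i. bary q (\<lambda>t. cc [(t, f i), (1 - t, x)]))"
    using assms(1,2) fixed by (simp add: bary_pair bary_commute[of q p])
  also have "\<dots> = bary p (\<lambda>i. cc [(e, f i), (1 - e, x)])"
  proof (rule bary_cong[OF assms(1)])
    fix i assume i: "i \<in> set_pmf p"
    let ?h = "\<lambda>b. if b then f i else x"
    have "bary q (\<lambda>t. cc [(t, f i), (1 - t, x)]) = bary q (\<lambda>t. bary (bernoulli_pmf t) ?h)"
      using assms(2,3) by (intro bary_cong) (simp_all add: bary_bernoulli)
    also have "\<dots> = bary (bind_pmf q bernoulli_pmf) ?h"
      using assms i by (intro bary_bind[symmetric]) auto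
    also have "\<dots> = cc [(e, f i), (1 - e, x)]"
      using e by (simp add: bary_bernoulli)
    finally show "bary q (\<lambda>t. cc [(t, f i), (1 - t, x)]) = cc [(e, f i), (1 - e, x)]" .
  qed
  also have "\<dots> = cc [(e, bary p f), (1 - e, x)]"
    using assms e by (simp add: bary_cc_pair bary_const)
  finally show ?thesis .
qed

end

section \<open>Laws of simple random elements\<close>

lemma nearest_index_exists:
  fixes n :: nat
  shows "\<exists>i\<le>n. dist (w i) x = Min ((\<lambda>j. dist (w j) x) ` {0..n})"
proof -
  have "Min ((\<lambda>j. dist (w j) x) ` {0..n}) \<in> (\<lambda>j. dist (w j) x) ` {0..n}"
    by (intro Min_in) auto
  then obtain i where "Min ((\<lambda>j. dist (w j) x) ` {0..n}) = dist (w i) x" "i \<in> {0..n}"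
    by (rule imageE)
  then show ?thesis
    by (intro exI[of _ i]) simp
qed

lemma nearest_index:
  shows nearest_index_le: "nearest_index w n x \<le> n"
    and dist_nearest_index: "dist (w (nearest_index w n x)) x = Min ((\<lambda>j. dist (w j) x) ` {0..n})"
  unfolding nearest_index_def using LeastI_ex[OF nearest_index_exists[of n w x]] by auto

lemma dist_nearest_point_le: "j \<le> n \<Longrightarrow> dist (nearest_point w n x) x \<le> dist (w j) x"
  unfolding nearest_point_def dist_nearest_index by (intro Min_le) auto

text \<open>For each fixed \<open>j\<close> the distance is eventually at most
  \<open>dist (w j) x\<close>, which density makes arbitrarily small.\<close>

lemma nearest_point_tendsto:
  assumes "x \<in> closure (range w)"
  shows "(\<lambda>n. dist (nearest_point w n x) x) \<longlonglongrightarrow> 0"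
proof (rule LIMSEQ_I)
  fix e :: real assume "0 < e"
  then obtain j where j: "dist (w j) x < e"
    using assms by (auto simp: closure_approachable)
  have "norm (dist (nearest_point w n x) x - 0) < e" if "j \<le> n" for n
    using dist_nearest_point_le[OF that, of w x] j by simp
  then show "\<exists>no. \<forall>n\<ge>no. norm (dist (nearest_point w n x) x - 0) < e"
    by blast
qed

lemma simple_function_nearest_point:
  fixes X :: "'w \<Rightarrow> 'a::metric_space"
  assumes [measurable]: "X \<in> borel_measurable M"
  shows "simple_function M (\<lambda>\<omega>. nearest_point w n (X \<omega>))"
proof -
  \<comment> \<open>Comparison with each candidate replaces the minimum, which writes the index as a
    \<open>LEAST\<close> over measurable conditions.\<close>
  have *: "nearest_index w n x = (LEAST i. i \<le> n \<and> (\<forall>j\<in>{0..n}. dist (w i) x \<le> dist (w j) x))" for x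
  proof -
    have "i \<le> n \<and> dist (w i) x = Min ((\<lambda>j. dist (w j) x) ` {0..n}) \<longleftrightarrow>
        i \<le> n \<and> (\<forall>j\<in>{0..n}. dist (w i) x \<le> dist (w j) x)" for i
      by (auto intro!: Min_eqI[symmetric])
    then show ?thesis
      by (simp add: nearest_index_def)
  qed
  have [measurable]: "(\<lambda>\<omega>. dist (w i) (X \<omega>)) \<in> borel_measurable M" for i
    by (rule measurable_compose[OF assms borel_measurable_continuous_onI]) (intro continuous_intros)
  have "(\<lambda>\<omega>. nearest_index w n (X \<omega>)) \<in> measurable M (count_space UNIV)"
    unfolding * by measurable
  moreover have "(\<lambda>\<omega>. nearest_index w n (X \<omega>)) ` space M \<subseteq> {0..n}"
    using nearest_index_le by auto
  ultimately have "simple_function M (\<lambda>\<omega>. nearest_index w n (X \<omega>))"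
    unfolding simple_function_eq_measurable by (auto intro: finite_subset)
  then show ?thesis
    unfolding nearest_point_def by (rule simple_function_compose1)
qed

text \<open>A weight that lies in the open unit interval only almost surely leaves the combination
  arbitrary on a null set; completeness makes this harmless.\<close>

lemma (in complete_measure) measurable_AE_eq:
  assumes "g \<in> measurable M N" "AE x in M. f x = g x" "\<And>x. x \<in> space M \<Longrightarrow> f x \<in> space N"
  shows "f \<in> measurable M N"
proof (rule measurableI)
  fix A assume A: "A \<in> sets N"
  show "f -` A \<inter> space M \<in> sets M"
  proof (rule in_sets_AE)
    show "AE x in M. x \<in> g -` A \<inter> space M \<longleftrightarrow> x \<in> f -` A \<inter> space M"
      using assms(2) by eventually_elim auto
  qed (use A assms(1) in auto)
qed (rule assms(3))

text \<open>Unspecified unless \<open>X\<close> is a simple function, because of \<open>Abs_pmf\<close>.\<close>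

definition simple_law :: "'w measure \<Rightarrow> ('w \<Rightarrow> 'i) \<Rightarrow> 'i pmf" where
  "simple_law M X = Abs_pmf (distr M (count_space UNIV) X)"

context prob_space
begin

lemma measure_pmf_simple_law:
  assumes "simple_function M X"
  shows "measure_pmf (simple_law M X) = distr M (count_space UNIV) X"
  unfolding simple_law_def
proof (rule Abs_pmf_inverse, intro CollectI conjI)
  have [measurable]: "X \<in> measurable M (count_space UNIV)"
    by (rule measurable_simple_function[OF assms])
  show "prob_space (distr M (count_space UNIV) X)"
    by (rule prob_space_distr) measurable
  have fin: "finite (X ` space M)"
    by (rule simple_functionD(1)[OF assms])
  \<comment> \<open>There are finitely many values, so the almost sure statements for the single
    values can be combined.\<close>
  have "AE \<omega> in M. X \<omega> = x \<longrightarrow> prob (X -` {x} \<inter> space M) \<noteq> 0" for x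
  proof (cases "prob (X -` {x} \<inter> space M) = 0")
    case True
    have "X -` {x} \<inter> space M \<in> null_sets M"
      using True by (intro null_setsI) (auto simp: emeasure_eq_measure)
    then show ?thesis
      by (rule AE_I') auto
  qed simp
  then have "AE \<omega> in M. \<forall>x\<in>X ` space M. X \<omega> = x \<longrightarrow> prob (X -` {x} \<inter> space M) \<noteq> 0"
    by (intro AE_finite_allI[OF fin])
  then have "AE \<omega> in M. measure (distr M (count_space UNIV) X) {X \<omega>} \<noteq> 0"
    using AE_space by eventually_elim (auto simp: measure_distr)
  then show "AE x in distr M (count_space UNIV) X. measure (distr M (count_space UNIV) X) {x} \<noteq> 0"
    by (subst AE_distr_iff) auto
qed simp

lemma pmf_simple_law:
  assumes "simple_function M X"
  shows "pmf (simple_law M X) x = prob (X -` {x} \<inter> space M)"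
  unfolding pmf.rep_eq measure_pmf_simple_law[OF assms]
  using measurable_simple_function[OF assms] by (simp add: measure_distr)

lemma set_pmf_simple_law:
  assumes "simple_function M X"
  shows "set_pmf (simple_law M X) \<subseteq> X ` space M"
proof
  fix x assume "x \<in> set_pmf (simple_law M X)"
  then have "X -` {x} \<inter> space M \<noteq> {}"
    by (auto simp: set_pmf_iff pmf_simple_law[OF assms] simp del: vimage_eq)
  then show "x \<in> X ` space M"
    by auto
qed

lemma finite_set_pmf_simple_law: "simple_function M X \<Longrightarrow> finite (set_pmf (simple_law M X))"
  using set_pmf_simple_law simple_functionD(1) finite_subset by metis

lemma simple_law_compose:
  assumes "simple_function M X"
  shows "simple_law M (\<lambda>\<omega>. g (X \<omega>)) = map_pmf g (simple_law M X)"
proof -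
  have "measure_pmf (simple_law M (\<lambda>\<omega>. g (X \<omega>))) = measure_pmf (map_pmf g (simple_law M X))"
    using assms measurable_simple_function[OF assms]
    by (simp add: measure_pmf_simple_law simple_function_compose1 map_pmf_rep_eq distr_distr o_def)
  then show ?thesis
    by (simp add: measure_pmf_inject)
qed

lemma expectation_simple_law:
  fixes h :: "'i \<Rightarrow> real"
  assumes "simple_function M X"
  shows "measure_pmf.expectation (simple_law M X) h = expectation (\<lambda>\<omega>. h (X \<omega>))"
  unfolding measure_pmf_simple_law[OF assms]
  using measurable_simple_function[OF assms] by (subst integral_distr) auto

end

section \<open>Expectation as a limit of simple expectations\<close>

lemma approximating_sequence_dense:
  assumes "approximating_sequence cc w"
  shows "x \<in> closure (range w)"
proof -
  have "closure (w ` {1..}) \<subseteq> closure (range w)"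
    by (intro closure_mono) auto
  then show ?thesis
    using assms by (auto simp: approximating_sequence_def)
qed

lemma integrable_elementD:
  fixes X :: "'w \<Rightarrow> 'a::{metric_space, second_countable_topology}"
  assumes "integrable_element M X"
  shows "X \<in> borel_measurable M" "finite_measure M \<Longrightarrow> integrable M (\<lambda>\<omega>. dist c (X \<omega>))"
proof -
  show [measurable]: "X \<in> borel_measurable M"
    using assms by (simp add: integrable_element_def)
  assume "finite_measure M"
  then interpret finite_measure M .
  obtain u where u: "integrable M (\<lambda>\<omega>. dist u (X \<omega>))"
    using assms by (auto simp: integrable_element_def)
  show "integrable M (\<lambda>\<omega>. dist c (X \<omega>))"
  proof (rule Bochner_Integration.integrable_bound)
    show "integrable M (\<lambda>\<omega>. dist c u + dist u (X \<omega>))"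
      using u by simp
    show "AE \<omega> in M. norm (dist c (X \<omega>)) \<le> norm (dist c u + dist u (X \<omega>))"
      by (simp add: dist_triangle)
  qed simp
qed

lemma integrable_dist:
  fixes X Y :: "'w \<Rightarrow> 'a::{metric_space, second_countable_topology}"
  assumes "finite_measure M" "integrable_element M X" "integrable_element M Y"
  shows "integrable M (\<lambda>\<omega>. dist (X \<omega>) (Y \<omega>))"
proof (rule Bochner_Integration.integrable_bound)
  have [measurable]: "X \<in> borel_measurable M" "Y \<in> borel_measurable M"
    using assms integrable_elementD(1) by auto
  show "integrable M (\<lambda>\<omega>. dist c (X \<omega>) + dist c (Y \<omega>))" for c
    using assms by (intro Bochner_Integration.integrable_add integrable_elementD(2))
  show "AE \<omega> in M. norm (dist (X \<omega>) (Y \<omega>)) \<le> norm (dist c (X \<omega>) + dist c (Y \<omega>))" for c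
    by (simp add: dist_triangle3)
  show "(\<lambda>\<omega>. dist (X \<omega>) (Y \<omega>)) \<in> borel_measurable M"
    by measurable
qed

lemma integrable_element_bound:
  fixes X Y :: "'w \<Rightarrow> 'a::{metric_space, second_countable_topology}"
  assumes "X \<in> borel_measurable M" "integrable M g" "AE \<omega> in M. dist c (X \<omega>) \<le> g \<omega>"
  shows "integrable_element M X"
  unfolding integrable_element_def
proof (intro conjI exI)
  have [measurable]: "X \<in> borel_measurable M" by fact
  show "integrable M (\<lambda>\<omega>. dist c (X \<omega>))"
  proof (rule Bochner_Integration.integrable_bound[OF assms(2)])
    show "AE \<omega> in M. norm (dist c (X \<omega>)) \<le> norm (g \<omega>)"
      using assms(3) by eventually_elim simp
  qed simp
qed fact

lemma (in finite_measure) integrable_element_simple: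
  fixes X :: "'a \<Rightarrow> 'b::{metric_space, second_countable_topology}"
  assumes "simple_function M X"
  shows "integrable_element M X"
proof (rule integrable_element_bound)
  show "X \<in> borel_measurable M"
    using measurable_simple_function[OF assms] by (rule measurable_compose) simp
  show "AE \<omega> in M. dist c (X \<omega>) \<le> Max (dist c ` X ` space M)" for c
    using simple_functionD(1)[OF assms] by (intro AE_I2 Max_ge) auto
qed simp

locale cc_prob_space = cc_space cc + prob_space M
  for cc :: "(real \<times> 'a::polish_space) list \<Rightarrow> 'a" and M :: "'w measure"
begin

lemma K_measurable [measurable]: "K \<in> borel_measurable borel"
proof (rule borel_measurable_continuous_onI)
  have "1-lipschitz_on UNIV K"
    by (intro lipschitz_onI) (auto simp: dist_K_le)
  then show "continuous_on UNIV K"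
    by (rule lipschitz_on_continuous_on)
qed

lemma integrable_element_K:
  assumes "integrable_element M X"
  shows "integrable_element M (\<lambda>\<omega>. K (X \<omega>))"
proof (rule integrable_element_bound)
  show "(\<lambda>\<omega>. K (X \<omega>)) \<in> borel_measurable M"
    using integrable_elementD(1)[OF assms] by measurable
  show "AE \<omega> in M. dist (K c) (K (X \<omega>)) \<le> dist c (X \<omega>)" for c
    by (simp add: dist_K_le)
  show "integrable M (\<lambda>\<omega>. dist c (X \<omega>))" for c
    by (rule integrable_elementD(2)[OF assms]) unfold_locales
qed

lemma integrable_dist_K:
  "integrable_element M X \<Longrightarrow> integrable_element M Y \<Longrightarrow> integrable M (\<lambda>\<omega>. dist (K (X \<omega>)) (K (Y \<omega>)))"
  by (intro integrable_dist integrable_element_K) unfold_locales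

text \<open>The weights are the point masses of the law, so discarding zeros cuts the list of values
  down to an enumeration of the support.\<close>

lemma simple_expectation_bary:
  assumes X: "simple_function M X"
  shows "simple_expectation cc M X = bary (simple_law M X) K"
proof -
  let ?p = "simple_law M X"
  define xs where "xs = (SOME xs. distinct xs \<and> set xs = X ` space M)"
  have "\<exists>xs. distinct xs \<and> set xs = X ` space M"
    using finite_distinct_list[OF simple_functionD(1)[OF X]] by blast
  then have xs: "distinct xs \<and> set xs = X ` space M"
    unfolding xs_def by (rule someI_ex)
  have "simple_expectation cc M X = cc (map (\<lambda>x. (pmf ?p x, K x)) (filter (\<lambda>x. pmf ?p x \<noteq> 0) xs))"
    unfolding simple_expectation_def xs_def[symmetric] Let_def discard_zero_weights_def
    by (simp add: filter_map o_def pmf_simple_law[OF X])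
  also have "\<dots> = bary ?p K"
    using xs set_pmf_simple_law[OF X] by (intro bary_enum[symmetric]) (auto simp: set_pmf_iff)
  finally show ?thesis .
qed

text \<open>With a pair-valued \<open>X\<close>, both components and their combinations become
  barycentres over one joint law, a common index for comparing them.\<close>

lemma simple_expectation_compose:
  assumes "simple_function M X"
  shows "simple_expectation cc M (\<lambda>\<omega>. g (X \<omega>)) = bary (simple_law M X) (\<lambda>x. K (g x))"
  using assms
  by (simp add: simple_expectation_bary simple_function_compose1 simple_law_compose bary_map finite_set_pmf_simple_law)

lemma dist_simple_expectation_le:
  assumes X: "simple_function M X" and Y: "simple_function M Y"
  shows "dist (simple_expectation cc M X) (simple_expectation cc M Y) \<le>
    expectation (\<lambda>\<omega>. dist (K (X \<omega>)) (K (Y \<omega>)))"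
proof -
  let ?Z = "\<lambda>\<omega>. (X \<omega>, Y \<omega>)"
  have Z: "simple_function M ?Z"
    using X Y by (rule simple_function_Pair)
  have "dist (bary (simple_law M ?Z) (\<lambda>z. K (fst z))) (bary (simple_law M ?Z) (\<lambda>z. K (snd z)))
      \<le> measure_pmf.expectation (simple_law M ?Z) (\<lambda>z. dist (K (fst z)) (K (snd z)))"
    by (rule dist_bary_le[OF finite_set_pmf_simple_law[OF Z]])
  then show ?thesis
    using simple_expectation_compose[OF Z, of fst] simple_expectation_compose[OF Z, of snd]
    by (simp add: expectation_simple_law[OF Z])
qed

text \<open>Approximants are compared with each other through their distances to \<open>Z\<close>,
  which need not be simple and so has no simple expectation itself.\<close>

lemma dist_simple_expectation_le2:
  assumes "simple_function M X" "simple_function M Y" "integrable_element M Z"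
  shows "dist (simple_expectation cc M X) (simple_expectation cc M Y) \<le>
    expectation (\<lambda>\<omega>. dist (K (X \<omega>)) (K (Z \<omega>))) + expectation (\<lambda>\<omega>. dist (K (Y \<omega>)) (K (Z \<omega>)))"
proof -
  note int = integrable_element_simple[OF assms(1)] integrable_element_simple[OF assms(2)] assms(3)
  have "expectation (\<lambda>\<omega>. dist (K (X \<omega>)) (K (Y \<omega>))) \<le>
      expectation (\<lambda>\<omega>. dist (K (X \<omega>)) (K (Z \<omega>)) + dist (K (Y \<omega>)) (K (Z \<omega>)))"
    using int by (intro integral_mono integrable_dist_K Bochner_Integration.integrable_add dist_triangle2)
  also have "\<dots> = expectation (\<lambda>\<omega>. dist (K (X \<omega>)) (K (Z \<omega>))) + expectation (\<lambda>\<omega>. dist (K (Y \<omega>)) (K (Z \<omega>)))"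
    using int by (intro Bochner_Integration.integral_add integrable_dist_K)
  finally show ?thesis
    using dist_simple_expectation_le[OF assms(1,2)] by linarith
qed

lemma expectation_dist_nearest_point:
  assumes "approximating_sequence cc w" "integrable_element M X"
  shows "(\<lambda>n. expectation (\<lambda>\<omega>. dist (nearest_point w n (X \<omega>)) (X \<omega>))) \<longlonglongrightarrow> 0"
proof -
  have [measurable]: "X \<in> borel_measurable M"
    by (rule integrable_elementD(1)[OF assms(2)])
  have "(\<lambda>n. expectation (\<lambda>\<omega>. dist (nearest_point w n (X \<omega>)) (X \<omega>))) \<longlonglongrightarrow> expectation (\<lambda>\<omega>. 0)"
  proof (rule integral_dominated_convergence)
    \<comment> \<open>\<open>w 0\<close> is a candidate at every stage, so the nearest point is at
      least as close as \<open>w 0\<close>.\<close>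
    show "integrable M (\<lambda>\<omega>. dist (w 0) (X \<omega>))"
      by (rule integrable_elementD(2)[OF assms(2)]) unfold_locales
    show "(\<lambda>\<omega>. dist (nearest_point w n (X \<omega>)) (X \<omega>)) \<in> borel_measurable M" for n
      using integrable_elementD(1)[OF integrable_element_simple[OF simple_function_nearest_point[of X M w n]]]
      by measurable
    show "AE \<omega> in M. (\<lambda>n. dist (nearest_point w n (X \<omega>)) (X \<omega>)) \<longlonglongrightarrow> 0"
      using nearest_point_tendsto[OF approximating_sequence_dense[OF assms(1)]] by simp
    show "AE \<omega> in M. norm (dist (nearest_point w n (X \<omega>)) (X \<omega>)) \<le> dist (w 0) (X \<omega>)" for n
      using dist_nearest_point_le[of 0 n w] by simp
  qed simp
  then show ?thesis
    by simp
qed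

lemma expectation_dist_K_nearest_point:
  assumes w: "approximating_sequence cc w" and X: "integrable_element M X"
  shows "(\<lambda>n. expectation (\<lambda>\<omega>. dist (K (nearest_point w n (X \<omega>))) (K (X \<omega>)))) \<longlonglongrightarrow> 0"
proof (rule tendsto_sandwich[OF _ _ tendsto_const expectation_dist_nearest_point[OF w X]])
  show "\<forall>\<^sub>F n in sequentially. expectation (\<lambda>\<omega>. dist (K (nearest_point w n (X \<omega>))) (K (X \<omega>)))
      \<le> expectation (\<lambda>\<omega>. dist (nearest_point w n (X \<omega>)) (X \<omega>))"
    using integrable_element_simple[OF simple_function_nearest_point[OF integrable_elementD(1)[OF X]]] X
    by (intro always_eventually allI integral_mono integrable_dist_K integrable_dist dist_K_le) unfold_locales
qed simp

lemma cc_expectation_tendsto: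
  assumes w: "approximating_sequence cc w" and Z: "integrable_element M Z"
    and S: "\<And>n. simple_function M (S n)"
    and lim: "(\<lambda>n. expectation (\<lambda>\<omega>. dist (K (S n \<omega>)) (K (Z \<omega>)))) \<longlonglongrightarrow> 0"
  shows "(\<lambda>n. simple_expectation cc M (S n)) \<longlonglongrightarrow> cc_expectation cc w M Z"
proof -
  define T where "T n \<omega> = nearest_point w n (Z \<omega>)" for n \<omega>
  define e where "e n = simple_expectation cc M (T n)" for n
  define a where "a n = expectation (\<lambda>\<omega>. dist (K (T n \<omega>)) (K (Z \<omega>)))" for n
  have T: "simple_function M (T n)" for n
    unfolding T_def by (rule simple_function_nearest_point[OF integrable_elementD(1)[OF Z]])
  have a: "a \<longlonglongrightarrow> 0"
    unfolding a_def T_def by (rule expectation_dist_K_nearest_point[OF w Z])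
  \<comment> \<open>The expectation is defined through \<open>lim\<close>, so convergence has to be
    established; completeness of the space yields it from the mean-distance bound.\<close>
  have "Cauchy e"
  proof (rule metric_CauchyI)
    fix r :: real assume "0 < r"
    then have "\<forall>\<^sub>F n in sequentially. a n < r / 2"
      using a by (intro order_tendstoD(2)) auto
    then obtain N where N: "\<And>n. N \<le> n \<Longrightarrow> a n < r / 2"
      by (auto simp: eventually_sequentially)
    have "dist (e m) (e n) < r" if "N \<le> m" "N \<le> n" for m n
      using dist_simple_expectation_le2[OF T[of m] T[of n] Z] N[OF that(1)] N[OF that(2)]
      unfolding e_def a_def by linarith
    then show "\<exists>N. \<forall>m\<ge>N. \<forall>n\<ge>N. dist (e m) (e n) < r"
      by blast
  qed
  then have "convergent e"
    by (rule Cauchy_convergent)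
  then have e: "e \<longlonglongrightarrow> cc_expectation cc w M Z"
    unfolding convergent_LIMSEQ_iff cc_expectation_def e_def T_def .
  let ?d = "\<lambda>n. expectation (\<lambda>\<omega>. dist (K (S n \<omega>)) (K (Z \<omega>))) + a n + dist (e n) (cc_expectation cc w M Z)"
  show ?thesis
    unfolding tendsto_dist_iff[of _ "cc_expectation cc w M Z"]
  proof (rule tendsto_sandwich[OF _ _ tendsto_const])
    have "?d \<longlonglongrightarrow> 0 + 0 + 0"
      using lim a e by (intro tendsto_add) (auto simp: tendsto_dist_iff[symmetric])
    then show "?d \<longlonglongrightarrow> 0"
      by simp
    have "dist (simple_expectation cc M (S n)) (cc_expectation cc w M Z) \<le> ?d n" for n
      using dist_simple_expectation_le2[OF S[of n] T[of n] Z]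
        dist_triangle[of "simple_expectation cc M (S n)" "cc_expectation cc w M Z" "e n"]
      unfolding e_def a_def by linarith
    then show "\<forall>\<^sub>F n in sequentially. dist (simple_expectation cc M (S n)) (cc_expectation cc w M Z) \<le> ?d n"
      by simp
  qed simp
qed

lemma cc_expectation_nearest_point:
  assumes w: "approximating_sequence cc w" and X: "integrable_element M X"
  shows "(\<lambda>n. simple_expectation cc M (\<lambda>\<omega>. nearest_point w n (X \<omega>))) \<longlonglongrightarrow> cc_expectation cc w M X"
  by (rule cc_expectation_tendsto[OF w X simple_function_nearest_point[OF integrable_elementD(1)[OF X]]
        expectation_dist_K_nearest_point[OF w X]])

end

section \<open>Combinations of random elements\<close>

text \<open>
  The offset \<open>1 / 2\<close> and the default value keep the discretized weights strictly inside the unit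
  interval, where combinations are constrained.
\<close>

definition discretize :: "nat \<Rightarrow> real \<Rightarrow> real" where
  "discretize n t = (if 0 < t \<and> t < 1 then (of_int \<lfloor>real (Suc n) * t\<rfloor> + 1 / 2) / real (Suc n) else 1 / 2)"

lemma discretize_floor:
  assumes "0 < t" "t < 1"
  shows "\<lfloor>real (Suc n) * t\<rfloor> \<in> {0..int n}"
proof -
  have "real (Suc n) * t < real (Suc n) * 1"
    using assms by (intro mult_strict_left_mono) auto
  then have "\<lfloor>real (Suc n) * t\<rfloor> < int (Suc n)"
    by (simp only: floor_less_iff) simp
  moreover have "0 \<le> \<lfloor>real (Suc n) * t\<rfloor>"
    using assms by simp
  ultimately show ?thesis
    by simp
qed

lemma discretize_bounds: "0 < discretize n t" "discretize n t < 1"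
proof -
  have bound: "0 < (of_int k + 1 / 2) / real (Suc n)" "(of_int k + 1 / 2) / real (Suc n) < 1" if "k \<in> {0..int n}" for k
  proof -
    have "0 \<le> k" "k \<le> int n"
      using that by auto
    then have "0 \<le> real_of_int k" "real_of_int k \<le> real n"
      by linarith+
    then show "0 < (of_int k + 1 / 2) / real (Suc n)" "(of_int k + 1 / 2) / real (Suc n) < 1"
      by (simp_all add: divide_simps)
  qed
  have "0 < discretize n t \<and> discretize n t < 1"
  proof (cases "0 < t \<and> t < 1")
    case True
    then show ?thesis
      unfolding discretize_def if_P[OF True] using bound[OF discretize_floor] by blast
  qed (auto simp: discretize_def)
  then show "0 < discretize n t" "discretize n t < 1"
    by auto
qed

lemma discretize_tendsto:
  assumes "0 < t" "t < 1"
  shows "(\<lambda>n. discretize n t) \<longlonglongrightarrow> t"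
proof -
  have bound: "norm (discretize n t - t) \<le> norm (inverse (real (Suc n))) * 1" for n
  proof -
    have "discretize n t - t = (of_int \<lfloor>real (Suc n) * t\<rfloor> + 1 / 2 - real (Suc n) * t) / real (Suc n)"
      using assms by (simp add: discretize_def field_simps)
    also have "norm \<dots> = \<bar>of_int \<lfloor>real (Suc n) * t\<rfloor> + 1 / 2 - real (Suc n) * t\<bar> / real (Suc n)"
      by (simp only: real_norm_def abs_divide abs_of_nat)
    also have "\<dots> \<le> 1 / real (Suc n)"
      by (rule divide_right_mono) linarith+
    finally show ?thesis
      by (simp add: divide_inverse)
  qed
  show ?thesis
    by (rule LIM_zero_cancel[OF tendsto_0_le[OF LIMSEQ_inverse_real_of_nat always_eventually[OF allI[OF bound]]]])
qed

lemma simple_function_discretize: "simple_function borel (discretize n)"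
proof (rule simple_function_borel_measurable)
  show "discretize n \<in> borel_measurable borel"
    unfolding discretize_def by measurable
  have "range (discretize n) \<subseteq> insert (1 / 2) ((\<lambda>k. (of_int k + 1 / 2) / real (Suc n)) ` {0..int n})"
    using discretize_floor[of _ n] unfolding discretize_def by auto
  then have "finite (range (discretize n))"
    by (rule finite_subset) simp
  then show "finite (discretize n ` space borel)"
    by simp
qed

text \<open>Level sets of the two discretized elements are preimages of Borel sets under
  \<open>X\<close> and \<open>Y\<close>, so the probabilities of their intersections
  factorize.\<close>

lemma (in prob_space) simple_law_independent:
  fixes f :: "'b::topological_space \<Rightarrow> 'i" and g :: "'c::topological_space \<Rightarrow> 'j"
  assumes ind: "independent_elements M X Y"
    and X: "X \<in> borel_measurable M" and Y: "Y \<in> borel_measurable M"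
    and f: "simple_function borel f" and g: "simple_function borel g"
  shows "simple_law M (\<lambda>\<omega>. (f (X \<omega>), g (Y \<omega>))) =
    pair_pmf (simple_law M (\<lambda>\<omega>. f (X \<omega>))) (simple_law M (\<lambda>\<omega>. g (Y \<omega>)))"
proof (rule pmf_eqI)
  have fX: "simple_function M (\<lambda>\<omega>. f (X \<omega>))" and gY: "simple_function M (\<lambda>\<omega>. g (Y \<omega>))"
    using simple_function_comp[OF X f] simple_function_comp[OF Y g] by auto
  fix z :: "'i \<times> 'j"
  obtain a b where z: "z = (a, b)"
    by fastforce
  have "f -` {a} \<in> sets borel" "g -` {b} \<in> sets borel"
    using simple_functionD(2)[OF f, of "{a}"] simple_functionD(2)[OF g, of "{b}"] by auto
  then have "X -` (f -` {a}) \<inter> space M \<in> sets (vimage_algebra (space M) X borel)"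
    "Y -` (g -` {b}) \<inter> space M \<in> sets (vimage_algebra (space M) Y borel)"
    by (auto intro: in_vimage_algebra)
  then have "prob ((X -` (f -` {a}) \<inter> space M) \<inter> (Y -` (g -` {b}) \<inter> space M)) =
      prob (X -` (f -` {a}) \<inter> space M) * prob (Y -` (g -` {b}) \<inter> space M)"
    using ind unfolding independent_elements_def by (rule indep_setD[rotated])
  moreover have "(X -` (f -` {a}) \<inter> space M) \<inter> (Y -` (g -` {b}) \<inter> space M) =
      (\<lambda>\<omega>. (f (X \<omega>), g (Y \<omega>))) -` {z} \<inter> space M"
    by (auto simp: z)
  moreover have "X -` (f -` {a}) = (\<lambda>\<omega>. f (X \<omega>)) -` {a}" "Y -` (g -` {b}) = (\<lambda>\<omega>. g (Y \<omega>)) -` {b}"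
    by auto
  ultimately show "pmf (simple_law M (\<lambda>\<omega>. (f (X \<omega>), g (Y \<omega>)))) z =
      pmf (pair_pmf (simple_law M (\<lambda>\<omega>. f (X \<omega>))) (simple_law M (\<lambda>\<omega>. g (Y \<omega>)))) z"
    using fX gY by (simp add: z pmf_pair pmf_simple_law simple_function_Pair)
qed

section \<open>Dominated approximation of combined random elements\<close>

context cc_space
begin

text \<open>Being fixed by \<open>K\<close>, the point \<open>c\<close> equals
  \<open>[t, c; 1 - t, c]\<close>, so (CC.iv) applies. Estimating the weights by 1 makes the bound
  uniform in \<open>t\<close>, as random weights require.\<close>

lemma dist_cc_pair_le:
  assumes "0 < t" "t < 1" "K c = c"
  shows "dist c (cc [(t, x), (1 - t, y)]) \<le> dist c x + dist c y"
proof -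
  have "dist (cc [(t, c), (1 - t, c)]) (cc [(t, x), (1 - t, y)]) \<le> t * dist c x + (1 - t) * dist c y"
    using assms by (intro cc_dist_le)
  also have "\<dots> \<le> dist c x + dist c y"
    using assms by (intro add_mono) (auto intro!: mult_left_le_one_le)
  finally show ?thesis
    using cc_K_self[OF assms(1,2), of c] assms(3) by simp
qed

lemma K_tendsto:
  assumes "(\<lambda>n. dist (x n) y) \<longlonglongrightarrow> 0"
  shows "(\<lambda>n. K (x n)) \<longlonglongrightarrow> K y"
  by (subst tendsto_dist_iff, rule tendsto_0_le[OF assms, where K = 1]) (simp add: dist_K_le)

end

context cc_prob_space
begin

text \<open>The combination is jointly continuous in weight and points on the region where the
  weight is strictly between 0 and 1.\<close>

lemma measurable_cc_pair:
  assumes [measurable]: "f \<in> borel_measurable M" "X \<in> borel_measurable M" "Y \<in> borel_measurable M"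
    and f: "\<And>\<omega>. 0 < f \<omega>" "\<And>\<omega>. f \<omega> < 1"
  shows "(\<lambda>\<omega>. cc [(f \<omega>, X \<omega>), (1 - f \<omega>, Y \<omega>)]) \<in> borel_measurable M"
proof -
  define S where "S = {0<..<1::real} \<times> (UNIV :: ('a \<times> 'a) set)"
  define F where "F z = cc [(fst z, fst (snd z)), (1 - fst z, snd (snd z))]" for z
  have "continuous_on S F"
  proof (rule continuous_on_sequentiallyI)
    fix u a assume "\<forall>n. u n \<in> S" "a \<in> S" "u \<longlonglongrightarrow> a"
    then show "(\<lambda>n. F (u n)) \<longlonglongrightarrow> F a"
      unfolding F_def by (intro cc_pair_tendsto tendsto_fst tendsto_snd) (auto simp: S_def mem_Times_iff)
  qed
  then have "F \<in> borel_measurable (restrict_space borel S)"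
    by (rule borel_measurable_continuous_on_restrict)
  moreover have "(\<lambda>\<omega>. (f \<omega>, X \<omega>, Y \<omega>)) \<in> measurable M (restrict_space borel S)"
    using f by (intro measurable_restrict_space2) (auto simp: S_def)
  ultimately have "(\<lambda>\<omega>. F (f \<omega>, X \<omega>, Y \<omega>)) \<in> borel_measurable M"
    by (rule measurable_compose[rotated])
  then show ?thesis
    by (simp add: F_def)
qed

text \<open>Serves constant and random weights alike: \<open>g n\<close> is the constant itself in
  one case and a discretization of the weight in the other.\<close>

lemma cc_expectation_cc_pair_tendsto:
  assumes w: "approximating_sequence cc w" and "complete_measure M"
    and X: "integrable_element M X" and Y: "integrable_element M Y"
    and f: "f \<in> borel_measurable M" "AE \<omega> in M. 0 < f \<omega> \<and> f \<omega> < 1"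
    and g: "\<And>n. simple_function M (g n)" "\<And>n \<omega>. 0 < g n \<omega>" "\<And>n \<omega>. g n \<omega> < 1"
    and lim: "AE \<omega> in M. (\<lambda>n. g n \<omega>) \<longlonglongrightarrow> f \<omega>"
  shows "(\<lambda>n. simple_expectation cc M
      (\<lambda>\<omega>. cc [(g n \<omega>, nearest_point w n (X \<omega>)), (1 - g n \<omega>, nearest_point w n (Y \<omega>))]))
    \<longlonglongrightarrow> cc_expectation cc w M (\<lambda>\<omega>. cc [(f \<omega>, X \<omega>), (1 - f \<omega>, Y \<omega>)])"
proof -
  interpret complete_measure M by fact
  define Z where "Z \<omega> = cc [(f \<omega>, X \<omega>), (1 - f \<omega>, Y \<omega>)]" for \<omega>
  define S where "S n \<omega> = cc [(g n \<omega>, nearest_point w n (X \<omega>)), (1 - g n \<omega>, nearest_point w n (Y \<omega>))]" for n \<omega>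
  \<comment> \<open>\<open>w 0\<close> has a double role: as a fixed point of \<open>K\<close> it is
    a centre for bounding combinations, and as a candidate at every stage it controls the nearest
    points.\<close>
  define c where "c = w 0"
  have c: "K c = c"
    using w by (auto simp: c_def approximating_sequence_def)
  note dense = approximating_sequence_dense[OF w]
  note [measurable] = f(1) integrable_elementD(1)[OF X] integrable_elementD(1)[OF Y]
  have Z_meas: "Z \<in> borel_measurable M"
  proof (rule measurable_AE_eq)
    \<comment> \<open>Redefining the weight on a null set keeps it inside the open unit interval
      everywhere.\<close>
    define f' where "f' \<omega> = (if 0 < f \<omega> \<and> f \<omega> < 1 then f \<omega> else 1 / 2)" for \<omega>
    have "f' \<in> borel_measurable M"
      unfolding f'_def by measurable
    then show "(\<lambda>\<omega>. cc [(f' \<omega>, X \<omega>), (1 - f' \<omega>, Y \<omega>)]) \<in> borel_measurable M"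
      by (rule measurable_cc_pair) (auto simp: f'_def)
    show "AE \<omega> in M. Z \<omega> = cc [(f' \<omega>, X \<omega>), (1 - f' \<omega>, Y \<omega>)]"
      using f(2) by eventually_elim (simp add: Z_def f'_def)
  qed simp
  have int: "integrable M (\<lambda>\<omega>. dist c (X \<omega>))" "integrable M (\<lambda>\<omega>. dist c (Y \<omega>))"
    using X Y finite_measure_axioms by (auto intro: integrable_elementD(2))
  have Z_bound: "AE \<omega> in M. dist c (Z \<omega>) \<le> dist c (X \<omega>) + dist c (Y \<omega>)"
    using f(2) by eventually_elim (simp add: Z_def dist_cc_pair_le c)
  have Z: "integrable_element M Z"
    using Z_meas Bochner_Integration.integrable_add[OF int] Z_bound by (rule integrable_element_bound)
  have S: "simple_function M (S n)" for n
  proof -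
    have "simple_function M (\<lambda>\<omega>. (g n \<omega>, nearest_point w n (X \<omega>), nearest_point w n (Y \<omega>)))"
      by (intro simple_function_Pair g simple_function_nearest_point) measurable
    from simple_function_compose1[OF this, of "\<lambda>(t, x, y). cc [(t, x), (1 - t, y)]"] show ?thesis
      by (simp add: S_def[abs_def])
  qed
  have near: "dist c (nearest_point w n x) \<le> 2 * dist c x" for n x
    using dist_nearest_point_le[of 0 n w x] dist_triangle[of c "nearest_point w n x" x]
    by (simp add: c_def dist_commute)
  have "(\<lambda>n. expectation (\<lambda>\<omega>. dist (K (S n \<omega>)) (K (Z \<omega>)))) \<longlonglongrightarrow> expectation (\<lambda>\<omega>. 0)"
  proof (rule integral_dominated_convergence)
    \<comment> \<open>The approximant contributes the factor 2 from \<open>near\<close>, the limit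
      \<open>Z\<close> the factor 1.\<close>
    show "integrable M (\<lambda>\<omega>. 3 * (dist c (X \<omega>) + dist c (Y \<omega>)))"
      using int by simp
    show "(\<lambda>\<omega>. dist (K (S n \<omega>)) (K (Z \<omega>))) \<in> borel_measurable M" for n
      using integrable_dist_K[OF integrable_element_simple[OF S] Z] by (rule borel_measurable_integrable)
    show "AE \<omega> in M. (\<lambda>n. dist (K (S n \<omega>)) (K (Z \<omega>))) \<longlonglongrightarrow> 0"
      using f(2) lim
    proof eventually_elim
      case (elim \<omega>)
      then have "(\<lambda>n. cc [(g n \<omega>, K (nearest_point w n (X \<omega>))), (1 - g n \<omega>, K (nearest_point w n (Y \<omega>)))])
          \<longlonglongrightarrow> cc [(f \<omega>, K (X \<omega>)), (1 - f \<omega>, K (Y \<omega>))]"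
        using g(2,3) by (intro cc_pair_tendsto K_tendsto nearest_point_tendsto dense) auto
      then show ?case
        using elim g(2,3) by (simp add: S_def Z_def K_cc_pair tendsto_dist_iff[symmetric])
    qed
    show "AE \<omega> in M. norm (dist (K (S n \<omega>)) (K (Z \<omega>))) \<le> 3 * (dist c (X \<omega>) + dist c (Y \<omega>))" for n
      using Z_bound
    proof eventually_elim
      case (elim \<omega>)
      have "dist (K (S n \<omega>)) (K (Z \<omega>)) \<le> dist c (S n \<omega>) + dist c (Z \<omega>)"
        using dist_K_le[of "S n \<omega>" "Z \<omega>"] dist_triangle3[of "S n \<omega>" "Z \<omega>" c] by linarith
      moreover have "dist c (S n \<omega>) \<le> dist c (nearest_point w n (X \<omega>)) + dist c (nearest_point w n (Y \<omega>))"
        unfolding S_def by (rule dist_cc_pair_le[OF g(2,3) c])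
      ultimately show ?case
        using elim near[of n "X \<omega>"] near[of n "Y \<omega>"] by simp
    qed
  qed simp
  then have "(\<lambda>n. expectation (\<lambda>\<omega>. dist (K (S n \<omega>)) (K (Z \<omega>)))) \<longlonglongrightarrow> 0"
    by simp
  from cc_expectation_tendsto[of w Z S, OF w Z S this] show ?thesis
    unfolding S_def[abs_def] Z_def[abs_def] .
qed

lemma cc_expectation_const:
  assumes w: "approximating_sequence cc w"
  shows "cc_expectation cc w M (\<lambda>_. u) = K u"
proof -
  have int: "integrable_element M (\<lambda>_. u)"
    by (rule integrable_element_simple) simp
  \<comment> \<open>Writing the constant as a function of a unit-valued element brings it to the
    form of a barycentre of equal points.\<close>
  have *: "simple_expectation cc M (\<lambda>_. x) = K x" for x
    using simple_expectation_compose[of "\<lambda>_. ()" "\<lambda>_. x"]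
    by (simp add: bary_const finite_set_pmf_simple_law)
  note dense = approximating_sequence_dense[OF w]
  have "(\<lambda>n. K (nearest_point w n u)) \<longlonglongrightarrow> cc_expectation cc w M (\<lambda>_. u)"
    using cc_expectation_nearest_point[OF w int] by (simp add: *)
  moreover have "(\<lambda>n. K (nearest_point w n u)) \<longlonglongrightarrow> K u"
    by (intro K_tendsto nearest_point_tendsto dense)
  ultimately show ?thesis
    by (rule LIMSEQ_unique)
qed

lemma cc_expectation_cc_pair:
  assumes w: "approximating_sequence cc w" and M: "complete_measure M"
    and X: "integrable_element M X" and Y: "integrable_element M Y"
    and t: "0 < t" "t < 1"
  shows "cc_expectation cc w M (\<lambda>\<omega>. cc [(t, X \<omega>), (1 - t, Y \<omega>)]) =
    cc [(t, cc_expectation cc w M X), (1 - t, cc_expectation cc w M Y)]"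
proof -
  let ?X = "\<lambda>n \<omega>. nearest_point w n (X \<omega>)" and ?Y = "\<lambda>n \<omega>. nearest_point w n (Y \<omega>)"
  have 1: "(\<lambda>n. simple_expectation cc M (\<lambda>\<omega>. cc [(t, ?X n \<omega>), (1 - t, ?Y n \<omega>)]))
      \<longlonglongrightarrow> cc_expectation cc w M (\<lambda>\<omega>. cc [(t, X \<omega>), (1 - t, Y \<omega>)])"
    using t by (intro cc_expectation_cc_pair_tendsto[OF w M X Y]) auto
  have "simple_expectation cc M (\<lambda>\<omega>. cc [(t, ?X n \<omega>), (1 - t, ?Y n \<omega>)]) =
      cc [(t, simple_expectation cc M (?X n)), (1 - t, simple_expectation cc M (?Y n))]" for n
  proof -
    \<comment> \<open>Working over the joint law lets the two components depend on each other
      arbitrarily.\<close>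
    have Z: "simple_function M (\<lambda>\<omega>. (?X n \<omega>, ?Y n \<omega>))" (is "simple_function M ?Z")
      by (intro simple_function_Pair simple_function_nearest_point integrable_elementD(1) X Y)
    have "simple_expectation cc M (\<lambda>\<omega>. cc [(t, ?X n \<omega>), (1 - t, ?Y n \<omega>)]) =
        bary (simple_law M ?Z) (\<lambda>z. cc [(t, K (fst z)), (1 - t, K (snd z))])"
      using simple_expectation_compose[OF Z, of "\<lambda>z. cc [(t, fst z), (1 - t, snd z)]"] t by (simp add: K_cc_pair)
    also have "\<dots> = cc [(t, bary (simple_law M ?Z) (\<lambda>z. K (fst z))), (1 - t, bary (simple_law M ?Z) (\<lambda>z. K (snd z)))]"
      using t by (intro bary_cc_pair finite_set_pmf_simple_law Z) auto
    finally show ?thesis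
      using simple_expectation_compose[OF Z, of fst] simple_expectation_compose[OF Z, of snd] by simp
  qed
  moreover have "(\<lambda>n. cc [(t, simple_expectation cc M (?X n)), (1 - t, simple_expectation cc M (?Y n))])
      \<longlonglongrightarrow> cc [(t, cc_expectation cc w M X), (1 - t, cc_expectation cc w M Y)]"
    using t by (intro cc_pair_tendsto cc_expectation_nearest_point w X Y) auto
  ultimately show ?thesis
    using LIMSEQ_unique[OF 1] by simp
qed

lemma cc_expectation_random_weights:
  fixes \<xi> :: "'w \<Rightarrow> real"
  assumes w: "approximating_sequence cc w" and M: "complete_measure M"
    and X: "integrable_element M X"
    and \<xi>: "\<xi> \<in> borel_measurable M" "AE \<omega> in M. 0 < \<xi> \<omega> \<and> \<xi> \<omega> < 1"
    and ind: "independent_elements M \<xi> X"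
  shows "cc_expectation cc w M (\<lambda>\<omega>. cc [(\<xi> \<omega>, X \<omega>), (1 - \<xi> \<omega>, u)]) =
    cc [(expectation \<xi>, cc_expectation cc w M X), (1 - expectation \<xi>, K u)]"
proof -
  let ?X = "\<lambda>n \<omega>. nearest_point w n (X \<omega>)" and ?\<xi> = "\<lambda>n \<omega>. discretize n (\<xi> \<omega>)"
  have [measurable]: "X \<in> borel_measurable M" "\<xi> \<in> borel_measurable M"
    by (rule integrable_elementD(1)[OF X], fact)
  have near: "simple_function borel (nearest_point w n)" for n
    using simple_function_nearest_point[of "\<lambda>x. x" borel] by simp
  have s\<xi>: "simple_function M (?\<xi> n)" for n
    using \<xi>(1) simple_function_discretize by (rule simple_function_comp)
  have sX: "simple_function M (?X n)" for n
    by (rule simple_function_nearest_point) measurable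
  have lim: "AE \<omega> in M. (\<lambda>n. ?\<xi> n \<omega>) \<longlonglongrightarrow> \<xi> \<omega>"
    using \<xi>(2) by eventually_elim (simp add: discretize_tendsto)
  have "AE \<omega> in M. norm (\<xi> \<omega>) \<le> 1"
    using \<xi>(2) by eventually_elim auto
  then have int: "integrable M \<xi>"
    by (intro integrable_const_bound) auto
  have "AE \<omega> in M. 0 < \<xi> \<omega>" "AE \<omega> in M. \<xi> \<omega> < 1"
    using \<xi>(2) by (auto elim!: eventually_mono)
  then have e: "0 < expectation \<xi>" "expectation \<xi> < 1"
    using expectation_greater[OF int] expectation_less[OF int] by auto
  have e_lim: "(\<lambda>n. expectation (?\<xi> n)) \<longlonglongrightarrow> expectation \<xi>"
  proof (rule integral_dominated_convergence)
    show "AE \<omega> in M. norm (?\<xi> n \<omega>) \<le> 1" for n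
      using discretize_bounds[of n] by (intro AE_I2) (simp add: less_imp_le)
    show "?\<xi> n \<in> borel_measurable M" for n
      using s\<xi> by (rule borel_measurable_simple_function)
  qed (use lim in simp_all)
  \<comment> \<open>The constant \<open>u\<close> enters as a second random element, so it too is
    replaced by its nearest points.\<close>
  have eq: "simple_expectation cc M (\<lambda>\<omega>. cc [(?\<xi> n \<omega>, ?X n \<omega>), (1 - ?\<xi> n \<omega>, nearest_point w n u)]) =
      cc [(expectation (?\<xi> n), simple_expectation cc M (?X n)), (1 - expectation (?\<xi> n), K (nearest_point w n u))]"
    and e_n: "0 < expectation (?\<xi> n)" "expectation (?\<xi> n) < 1" for n
  proof -
    let ?q = "simple_law M (?\<xi> n)" and ?p = "simple_law M (?X n)" and ?u = "nearest_point w n u"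
    have fin: "finite (set_pmf ?q)" "finite (set_pmf ?p)"
      by (intro finite_set_pmf_simple_law s\<xi> sX)+
    have q: "0 < t \<and> t < 1" if "t \<in> set_pmf ?q" for t
      using that set_pmf_simple_law[OF s\<xi>[of n]] discretize_bounds[of n] by auto
    have exp: "measure_pmf.expectation ?q (\<lambda>t. t) = expectation (?\<xi> n)"
      by (rule expectation_simple_law[OF s\<xi>])
    show "0 < expectation (?\<xi> n)" "expectation (?\<xi> n) < 1"
      using bind_bernoulli_pmf(2,3)[where q = ?q, OF q] unfolding exp by auto
    have "simple_expectation cc M (\<lambda>\<omega>. cc [(?\<xi> n \<omega>, ?X n \<omega>), (1 - ?\<xi> n \<omega>, ?u)]) =
        bary (pair_pmf ?q ?p) (\<lambda>z. K (cc [(fst z, snd z), (1 - fst z, ?u)]))"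
      using simple_expectation_compose[OF simple_function_Pair[OF s\<xi>[of n] sX[of n]],
          of "\<lambda>z. cc [(fst z, snd z), (1 - fst z, ?u)]"]
        simple_law_independent[OF ind _ _ simple_function_discretize[of n] near[of n]] by simp
    also have "\<dots> = bary (pair_pmf ?q ?p) (\<lambda>(t, x). cc [(t, K x), (1 - t, K ?u)])"
      using fin q by (intro bary_cong) (auto simp: K_cc_pair)
    also have "\<dots> = cc [(expectation (?\<xi> n), bary ?p K), (1 - expectation (?\<xi> n), K ?u)]"
      using bary_random_weights[OF fin(2,1) q, of K "K ?u"] unfolding exp by simp
    finally show "simple_expectation cc M (\<lambda>\<omega>. cc [(?\<xi> n \<omega>, ?X n \<omega>), (1 - ?\<xi> n \<omega>, nearest_point w n u)]) =
      cc [(expectation (?\<xi> n), simple_expectation cc M (?X n)), (1 - expectation (?\<xi> n), K (nearest_point w n u))]"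
      by (simp add: simple_expectation_bary[OF sX])
  qed
  note dense = approximating_sequence_dense[OF w]
  have "integrable_element M (\<lambda>_. u)"
    by (rule integrable_element_simple) simp
  then have "(\<lambda>n. simple_expectation cc M (\<lambda>\<omega>. cc [(?\<xi> n \<omega>, ?X n \<omega>), (1 - ?\<xi> n \<omega>, nearest_point w n u)]))
      \<longlonglongrightarrow> cc_expectation cc w M (\<lambda>\<omega>. cc [(\<xi> \<omega>, X \<omega>), (1 - \<xi> \<omega>, u)])"
    using s\<xi> discretize_bounds lim by (intro cc_expectation_cc_pair_tendsto[OF w M X _ \<xi>]) auto
  moreover have "(\<lambda>n. cc [(expectation (?\<xi> n), simple_expectation cc M (?X n)),
        (1 - expectation (?\<xi> n), K (nearest_point w n u))])
      \<longlonglongrightarrow> cc [(expectation \<xi>, cc_expectation cc w M X), (1 - expectation \<xi>, K u)]"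
    by (intro cc_pair_tendsto e_n e e_lim cc_expectation_nearest_point w X K_tendsto nearest_point_tendsto dense)
  ultimately show ?thesis
    unfolding eq by (rule LIMSEQ_unique)
qed

text \<open>A constant generates the trivial \<sigma>-algebra, whose events have probability 0 or
  1.\<close>

lemma independent_elements_const:
  assumes "\<xi> \<in> borel_measurable M"
  shows "independent_elements M \<xi> (\<lambda>_. u)"
  unfolding independent_elements_def
proof (rule indep_setI)
  show "sets (vimage_algebra (space M) \<xi> borel) \<subseteq> events"
    using assms by (auto simp: sets_vimage_algebra2)
  show "sets (vimage_algebra (space M) (\<lambda>_. u) borel) \<subseteq> events"
    by (auto simp: sets_vimage_algebra2)
  fix a b assume "a \<in> sets (vimage_algebra (space M) \<xi> borel)" "b \<in> sets (vimage_algebra (space M) (\<lambda>_. u) borel)"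
  then have "a \<subseteq> space M" "b = {} \<or> b = space M"
    by (auto simp: sets_vimage_algebra2 split: if_splits)
  then show "prob (a \<inter> b) = prob a * prob b"
    by (auto simp: prob_space Int_absorb2)
qed

end

theorem corollary4p2:
  fixes cc :: "(real \<times> 'a::polish_space) list \<Rightarrow> 'a"
    and M :: "'w measure"
    and w :: "nat \<Rightarrow> 'a"
  assumes "cc_space cc"
    and "prob_space M" and "complete_measure M" and "atomless M"
    and "approximating_sequence cc w"
  shows
    "(\<forall>X1 X2 l1 l2. integrable_element M X1 \<longrightarrow> integrable_element M X2 \<longrightarrow>
        0 < l1 \<longrightarrow> 0 < l2 \<longrightarrow> l1 + l2 = 1 \<longrightarrow>
        cc_expectation cc w M (\<lambda>\<omega>. cc [(l1, X1 \<omega>), (l2, X2 \<omega>)]) =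
        cc [(l1, cc_expectation cc w M X1), (l2, cc_expectation cc w M X2)]) \<and>
     (\<forall>X (\<xi> :: 'w \<Rightarrow> real) u. integrable_element M X \<longrightarrow> \<xi> \<in> borel_measurable M \<longrightarrow>
        (AE \<omega> in M. 0 < \<xi> \<omega> \<and> \<xi> \<omega> < 1) \<longrightarrow> independent_elements M \<xi> X \<longrightarrow>
        cc_expectation cc w M (\<lambda>\<omega>. cc [(\<xi> \<omega>, X \<omega>), (1 - \<xi> \<omega>, u)]) =
        cc [(integral\<^sup>L M \<xi>, cc_expectation cc w M X),
            (1 - integral\<^sup>L M \<xi>, convexification cc u)]) \<and>
     (\<forall>(\<xi> :: 'w \<Rightarrow> real) u v. \<xi> \<in> borel_measurable M \<longrightarrow>
        (AE \<omega> in M. 0 < \<xi> \<omega> \<and> \<xi> \<omega> < 1) \<longrightarrow>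
        cc_expectation cc w M (\<lambda>\<omega>. cc [(\<xi> \<omega>, u), (1 - \<xi> \<omega>, v)]) =
        cc [(integral\<^sup>L M \<xi>, convexification cc u),
            (1 - integral\<^sup>L M \<xi>, convexification cc v)])"
proof -
  interpret cc_space cc by fact
  interpret prob_space M by fact
  interpret cc_prob_space cc M ..
  note w = \<open>approximating_sequence cc w\<close> and M = \<open>complete_measure M\<close>
  show ?thesis
  proof (intro conjI allI impI)
    fix X1 X2 :: "'w \<Rightarrow> 'a" and l1 l2 :: real
    assume X: "integrable_element M X1" "integrable_element M X2" and l: "0 < l1" "0 < l2" "l1 + l2 = 1"
    then have l2: "l2 = 1 - l1"
      by simp
    show "cc_expectation cc w M (\<lambda>\<omega>. cc [(l1, X1 \<omega>), (l2, X2 \<omega>)]) =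
        cc [(l1, cc_expectation cc w M X1), (l2, cc_expectation cc w M X2)]"
      unfolding l2 by (rule cc_expectation_cc_pair[OF w M X]) (use l in auto)
  next
    fix X :: "'w \<Rightarrow> 'a" and \<xi> :: "'w \<Rightarrow> real" and u
    assume "integrable_element M X" "\<xi> \<in> borel_measurable M" "AE \<omega> in M. 0 < \<xi> \<omega> \<and> \<xi> \<omega> < 1"
      "independent_elements M \<xi> X"
    then show "cc_expectation cc w M (\<lambda>\<omega>. cc [(\<xi> \<omega>, X \<omega>), (1 - \<xi> \<omega>, u)]) =
        cc [(integral\<^sup>L M \<xi>, cc_expectation cc w M X), (1 - integral\<^sup>L M \<xi>, convexification cc u)]"
      by (rule cc_expectation_random_weights[OF w M])
  next
    fix \<xi> :: "'w \<Rightarrow> real" and u v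
    assume "\<xi> \<in> borel_measurable M" "AE \<omega> in M. 0 < \<xi> \<omega> \<and> \<xi> \<omega> < 1"
    \<comment> \<open>The constant element \<open>u\<close> is independent of \<xi> and has
      expectation \<open>K u\<close>, so this is an instance of the second claim.\<close>
    then show "cc_expectation cc w M (\<lambda>\<omega>. cc [(\<xi> \<omega>, u), (1 - \<xi> \<omega>, v)]) =
        cc [(integral\<^sup>L M \<xi>, convexification cc u), (1 - integral\<^sup>L M \<xi>, convexification cc v)]"
      using cc_expectation_random_weights[OF w M, of "\<lambda>_. u" \<xi> v]
      by (simp add: integrable_element_simple independent_elements_const cc_expectation_const[OF w])
  qed
qed

end
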